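(* Let $n\ge1$. The $\mathfrak{S}_n$-module $A(X_{\widetilde{\Sigma}_n})=\widetilde{A}(\mathsf{B}_n)$ has permutation basis $\widetilde{FY}(\mathsf{B}_n)$, and for each $0\le k\le n$ its homogeneous component $\widetilde{A}^k(\mathsf{B}_n)$ has permutation basis $\widetilde{FY}^k(\mathsf{B}_n)$. That is, (the classes of) the monomials in $\widetilde{FY}(\mathsf{B}_n)$ (respectively $\widetilde{FY}^k(\mathsf{B}_n)$) form a $\mathbb{Q}$-basis of $\widetilde{A}(\mathsf{B}_n)$ (respectively $\widetilde{A}^k(\mathsf{B}_n)$) that is permuted by the action of $\mathfrak{S}_n$.
   Context: Write $[n]=\{1,\dots,n\}$. The Boolean matroid $\mathsf{B}_n$ is the matroid on $[n]$ in which every subset is independent; its flats are all subsets of $[n]$. Its augmented Chow ring is the graded $\mathbb{Q}$-algebra (all variables in degree $1$) $$\widetilde{A}(\mathsf{B}_n)=\mathbb{Q}\big[\{x_F\}_{F\subsetneq[n]}\cup\{y_1,\dots,y_n\}\big]\big/(I_1+I_2+I_3),$$ where $I_1=\langle x_Fx_G: F,G\text{ incomparable under inclusion}\rangle$, $I_2=\langle y_ix_F: i\notin F\rangle$, $I_3=\langle y_i-\sum_{F\subsetneq [n],\, i\notin F}x_F: 1\le i\le n\rangle$ (the index $F=\emptyset$ is allowed). In this ring $x_{[n]}$ denotes the element $-\sum_{F\subsetneq[n]}x_F$. $\widetilde{A}^k(\mathsf{B}_n)$ is the degree $k$ component. $\mathfrak{S}_n$ acts by $\sigma\cdot x_F=x_{\sigma(F)}$,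 $\sigma\cdot y_i=y_{\sigma(i)}$. Here $\widetilde{\Sigma}_n$ is the normal fan of the stellohedron (equivalently, the augmented Bergman fan of $\mathsf{B}_n$) and $X_{\widetilde\Sigma_n}$ is its toric variety (the stellahedral variety); its Chow ring $A(X_{\widetilde\Sigma_n})$ over $\mathbb{Q}$, i.e. the Stanley--Reisner ring of $\widetilde\Sigma_n$ modulo the linear relations, is $\widetilde A(\mathsf{B}_n)$, and it is isomorphic to $H^*(X_{\widetilde\Sigma_n},\mathbb{Q})$ as an $\mathfrak{S}_n$-module. $\widetilde{FY}(\mathsf{B}_n)$ is the set of monomials $x_{F_1}^{a_1}\cdots x_{F_\ell}^{a_\ell}$ with $\ell\ge0$, $\emptyset\subsetneq F_1\subsetneq\cdots\subsetneq F_\ell\subseteq[n]$, $1\le a_1\le|F_1|$, and $1\le a_i\le|F_i|-|F_{i-1}|-1$ for $i\ge2$ (the case $\ell=0$ is the monomial $1$). $\widetilde{FY}^k(\mathsf{B}_n)$ is the subset of monomials of degree $k$. A permutation basis of a $G$-module is a basis that is mapped to itself by every element of $G$. *)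

theory Defs
  imports
    "HOL-Analysis.Analysis"
    "HOL-Library.Poly_Mapping"
    "HOL-Combinatorics.Perm"
begin

text \<open>
  The ground set \<open>[n]\<close> is a finite type \<open>'n\<close> with \<open>n = CARD('n)\<close>; types are nonempty, so
  \<open>n \<ge> 1\<close>.  The symmetric group is the type \<open>'n perm\<close>, whose elements are all bijections
  of \<open>'n\<close>, as \<open>'n\<close> is finite.
\<close>

subsection \<open>Polynomial rings over the rationals\<close>

type_synonym 'v qpoly = "('v \<Rightarrow>\<^sub>0 nat) \<Rightarrow>\<^sub>0 rat"

definition pvar :: "'v \<Rightarrow> 'v qpoly"
  where "pvar v = Poly_Mapping.single (Poly_Mapping.single v 1) 1"

definition pconst :: "rat \<Rightarrow> 'v qpoly"
  where "pconst c = Poly_Mapping.single 0 c"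

definition mon_degree :: "('v \<Rightarrow>\<^sub>0 nat) \<Rightarrow> nat"
  where "mon_degree m = (\<Sum>v\<in>Poly_Mapping.keys m. Poly_Mapping.lookup m v)"

definition homogeneous :: "nat \<Rightarrow> 'v qpoly \<Rightarrow> bool"
  where "homogeneous k p \<longleftrightarrow> (\<forall>m\<in>Poly_Mapping.keys p. mon_degree m = k)"

definition ideal_gen :: "'a::comm_ring_1 set \<Rightarrow> 'a set"
  where "ideal_gen S = module.span (*) S"

definition map_mon :: "('v \<Rightarrow> 'w) \<Rightarrow> ('v \<Rightarrow>\<^sub>0 nat) \<Rightarrow> 'w \<Rightarrow>\<^sub>0 nat"
  where "map_mon f m =
    (\<Sum>v\<in>Poly_Mapping.keys m. Poly_Mapping.single (f v) (Poly_Mapping.lookup m v))"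

text \<open>The algebra homomorphism that substitutes the variable \<open>f v\<close> for \<open>v\<close>.\<close>

definition map_vars :: "('v \<Rightarrow> 'w) \<Rightarrow> 'v qpoly \<Rightarrow> 'w qpoly"
  where "map_vars f p =
    (\<Sum>m\<in>Poly_Mapping.keys p. Poly_Mapping.single (map_mon f m) (Poly_Mapping.lookup p m))"

lemma module_mult: "module ((*) :: 'a::comm_ring_1 \<Rightarrow> 'a \<Rightarrow> 'a)"
  by unfold_locales (simp_all add: algebra_simps)

lemma sum_keys_superset:
  assumes "finite A" "Poly_Mapping.keys p \<subseteq> A" "\<And>k. h k 0 = 0"
  shows "(\<Sum>k\<in>Poly_Mapping.keys p. h k (Poly_Mapping.lookup p k))
    = (\<Sum>k\<in>A. h k (Poly_Mapping.lookup p k))"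
  using assms by (intro sum.mono_neutral_left) (auto simp: in_keys_iff)

lemma sum_keys_add:
  assumes "\<And>k. h k 0 = 0" "\<And>k a b. h k (a + b) = h k a + h k b"
  shows "(\<Sum>k\<in>Poly_Mapping.keys (p + q). h k (Poly_Mapping.lookup (p + q) k))
    = (\<Sum>k\<in>Poly_Mapping.keys p. h k (Poly_Mapping.lookup p k))
    + (\<Sum>k\<in>Poly_Mapping.keys q. h k (Poly_Mapping.lookup q k))"
proof -
  let ?A = "Poly_Mapping.keys p \<union> Poly_Mapping.keys q"
  have "Poly_Mapping.keys (p + q) \<subseteq> ?A" by (rule Poly_Mapping.keys_add)
  then have "(\<Sum>k\<in>Poly_Mapping.keys (p + q). h k (Poly_Mapping.lookup (p + q) k))
    = (\<Sum>k\<in>?A. h k (Poly_Mapping.lookup (p + q) k))"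
    using assms by (intro sum_keys_superset) simp_all
  also have "\<dots> = (\<Sum>k\<in>?A. h k (Poly_Mapping.lookup p k))
    + (\<Sum>k\<in>?A. h k (Poly_Mapping.lookup q k))"
    by (simp add: lookup_add assms sum.distrib)
  also have "(\<Sum>k\<in>?A. h k (Poly_Mapping.lookup p k))
    = (\<Sum>k\<in>Poly_Mapping.keys p. h k (Poly_Mapping.lookup p k))"
    using assms by (intro sum_keys_superset[symmetric]) simp_all
  also have "(\<Sum>k\<in>?A. h k (Poly_Mapping.lookup q k))
    = (\<Sum>k\<in>Poly_Mapping.keys q. h k (Poly_Mapping.lookup q k))"
    using assms by (intro sum_keys_superset[symmetric]) simp_all
  finally show ?thesis .
qed

lemma map_mon_add: "map_mon f (m + m') = map_mon f m + map_mon f m'"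
  unfolding map_mon_def by (rule sum_keys_add) (simp_all add: single_add)

lemma map_vars_add: "map_vars f (p + q) = map_vars f p + map_vars f q"
  unfolding map_vars_def by (rule sum_keys_add) (simp_all add: single_add)

lemma map_vars_single [simp]:
  "map_vars f (Poly_Mapping.single m c) = Poly_Mapping.single (map_mon f m) c"
  by (cases "c = 0") (simp_all add: map_vars_def)

lemma map_vars_zero [simp]: "map_vars f 0 = 0"
  by (simp add: map_vars_def)

lemma map_vars_sum: "map_vars f (\<Sum>x\<in>A. g x) = (\<Sum>x\<in>A. map_vars f (g x))"
  by (induction A rule: infinite_finite_induct) (simp_all add: map_vars_add)

lemma map_vars_diff: "map_vars f (p - q) = map_vars f p - map_vars f q"
  using map_vars_add[of f "p - q" q] by simp

lemma qpoly_expand: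
  "(p :: 'v qpoly) = (\<Sum>m\<in>Poly_Mapping.keys p. Poly_Mapping.single m (Poly_Mapping.lookup p m))"
  by (rule poly_mapping_eqI)
    (simp add: lookup_sum lookup_single when_def in_keys_iff)

lemma map_vars_mult: "map_vars f (p * q) = map_vars f p * map_vars f q"
proof -
  have "p * q = (\<Sum>m\<in>Poly_Mapping.keys p. \<Sum>m'\<in>Poly_Mapping.keys q.
      Poly_Mapping.single (m + m') (Poly_Mapping.lookup p m * Poly_Mapping.lookup q m'))"
    by (subst (1) qpoly_expand[of p], subst (1) qpoly_expand[of q])
      (simp add: sum_product mult_single)
  then have "map_vars f (p * q) = (\<Sum>m\<in>Poly_Mapping.keys p. \<Sum>m'\<in>Poly_Mapping.keys q.
      Poly_Mapping.single (map_mon f m + map_mon f m')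
        (Poly_Mapping.lookup p m * Poly_Mapping.lookup q m'))"
    by (simp add: map_vars_sum map_mon_add)
  also have "\<dots> = map_vars f p * map_vars f q"
    by (simp add: map_vars_def sum_product mult_single)
  finally show ?thesis .
qed

lemma map_vars_pvar [simp]: "map_vars f (pvar v) = pvar (f v)"
  by (simp add: pvar_def map_mon_def)

subsection \<open>The augmented Chow ring of the Boolean matroid\<close>

typedef 'n proper_subset = "{F :: 'n set. F \<noteq> UNIV}"
  morphisms elems Proper
  by (rule exI[of _ "{}"]) simp

instance proper_subset :: (finite) finite
proof
  have "inj (elems :: 'a proper_subset \<Rightarrow> 'a set)"
    by (simp add: inj_def elems_inject)
  then show "finite (UNIV :: 'a proper_subset set)"
    by (rule inj_on_finite[of _ _ UNIV]) simp_all
qed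

datatype 'n chow_var = X "'n proper_subset" | Y 'n

instance chow_var :: (finite) finite
proof
  have "(UNIV :: 'a chow_var set) = range X \<union> range Y"
    by (metis UNIV_eq_I UnCI rangeI chow_var.exhaust)
  moreover have "finite (range X \<union> range Y :: 'a chow_var set)"
    by simp
  ultimately show "finite (UNIV :: 'a chow_var set)"
    by (simp only:)
qed

definition aug_gens1 :: "'n chow_var qpoly set"
  where "aug_gens1 = {pvar (X F) * pvar (X G) | F G.
    \<not> elems F \<subseteq> elems G \<and> \<not> elems G \<subseteq> elems F}"

definition aug_gens2 :: "'n chow_var qpoly set"
  where "aug_gens2 = {pvar (Y i) * pvar (X F) | i F. i \<notin> elems F}"

definition aug_gens3 :: "'n::finite chow_var qpoly set"
  where "aug_gens3 = {pvar (Y i) - (\<Sum>F | i \<notin> elems F. pvar (X F)) | i. True}"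

definition aug_ideal :: "'n::finite chow_var qpoly set"
  where "aug_ideal = ideal_gen (aug_gens1 \<union> aug_gens2 \<union> aug_gens3)"

definition aug_rel :: "'n::finite chow_var qpoly \<Rightarrow> 'n chow_var qpoly \<Rightarrow> bool"
  where "aug_rel p q \<longleftrightarrow> p - q \<in> aug_ideal"

lemma
  shows aug_ideal_zero: "0 \<in> aug_ideal"
    and aug_ideal_add: "p \<in> aug_ideal \<Longrightarrow> q \<in> aug_ideal \<Longrightarrow> p + q \<in> aug_ideal"
    and aug_ideal_diff: "p \<in> aug_ideal \<Longrightarrow> q \<in> aug_ideal \<Longrightarrow> p - q \<in> aug_ideal"
    and aug_ideal_mult: "p \<in> aug_ideal \<Longrightarrow> r * p \<in> aug_ideal"
  unfolding aug_ideal_def ideal_gen_def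
  by (simp_all add: module.span_zero module.span_add module.span_diff module.span_scale
      module_mult)

lemma aug_ideal_no_const: "p \<in> aug_ideal \<Longrightarrow> 0 \<notin> Poly_Mapping.keys p"
proof -
  assume p: "p \<in> aug_ideal"
  have mon: "m + m' = 0 \<Longrightarrow> m' = 0" for m m' :: "'a chow_var \<Rightarrow>\<^sub>0 nat"
    by (metis add_is_0 lookup_add lookup_zero poly_mapping_eqI)
  have mult: "0 \<notin> Poly_Mapping.keys (c * q)" if "0 \<notin> Poly_Mapping.keys q" for c q :: "'a chow_var qpoly"
  proof
    assume "0 \<in> Poly_Mapping.keys (c * q)"
    then obtain a b where "0 = a + b" "b \<in> Poly_Mapping.keys q"
      using keys_mult[of c q] by auto
    with mon[of a b] that show False by metis
  qed
  have ne: "Poly_Mapping.single v (1::nat) \<noteq> 0" for v :: "'a chow_var"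
    by (metis lookup_single_eq lookup_zero zero_neq_one)
  have v: "0 \<notin> Poly_Mapping.keys (pvar v)" for v :: "'a chow_var"
    using ne[of v] by (simp add: pvar_def)
  have sub: "module.subspace (*) {q :: 'a chow_var qpoly. 0 \<notin> Poly_Mapping.keys q}"
  proof (rule module.subspaceI[OF module_mult])
    fix p q :: "'a chow_var qpoly"
    assume "p \<in> {q. 0 \<notin> Poly_Mapping.keys q}" "q \<in> {q. 0 \<notin> Poly_Mapping.keys q}"
    then show "p + q \<in> {q. 0 \<notin> Poly_Mapping.keys q}"
      by (simp add: in_keys_iff lookup_add)
  qed (simp_all add: mult)
  have lin: "0 \<notin> Poly_Mapping.keys (pvar (Y i) - (\<Sum>F | i \<notin> elems F. pvar (X F)))" for i :: 'a
    using v by (simp add: in_keys_iff lookup_minus lookup_sum)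
  have gens: "aug_gens1 \<union> aug_gens2 \<union> aug_gens3 \<subseteq> {q :: 'a chow_var qpoly. 0 \<notin> Poly_Mapping.keys q}"
    using lin mult[OF v] unfolding aug_gens1_def aug_gens2_def aug_gens3_def by blast
  show ?thesis
    using module.span_minimal[OF module_mult gens sub] p
    unfolding aug_ideal_def ideal_gen_def by blast
qed

quotient_type (overloaded) 'n aug_chow = "('n::finite) chow_var qpoly" / aug_rel
  morphisms aug_rep aug_class
proof (rule equivpI)
  show "reflp (aug_rel :: 'n chow_var qpoly \<Rightarrow> _)"
    by (simp add: reflp_def aug_rel_def aug_ideal_zero)
  show "symp (aug_rel :: 'n chow_var qpoly \<Rightarrow> _)"
    using aug_ideal_diff[OF aug_ideal_zero] by (fastforce simp: symp_def aug_rel_def)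
  show "transp (aug_rel :: 'n chow_var qpoly \<Rightarrow> _)"
    using aug_ideal_add by (fastforce simp: transp_def aug_rel_def)
qed

instantiation aug_chow :: (finite) comm_ring_1
begin

lift_definition zero_aug_chow :: "'a aug_chow" is 0 .
lift_definition one_aug_chow :: "'a aug_chow" is 1 .
lift_definition plus_aug_chow :: "'a aug_chow \<Rightarrow> 'a aug_chow \<Rightarrow> 'a aug_chow" is "(+)"
  unfolding aug_rel_def by (simp add: add_diff_add aug_ideal_add)
lift_definition minus_aug_chow :: "'a aug_chow \<Rightarrow> 'a aug_chow \<Rightarrow> 'a aug_chow" is "(-)"
proof -
  fix p p' q q' :: "'a chow_var qpoly"
  assume "aug_rel p p'" "aug_rel q q'"
  moreover have "p - q - (p' - q') = (p - p') - (q - q')"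
    by (simp add: algebra_simps)
  ultimately show "aug_rel (p - q) (p' - q')"
    unfolding aug_rel_def by (simp only: aug_ideal_diff)
qed
lift_definition uminus_aug_chow :: "'a aug_chow \<Rightarrow> 'a aug_chow" is uminus
proof -
  fix p p' :: "'a chow_var qpoly"
  assume "aug_rel p p'"
  moreover have "- p - - p' = 0 - (p - p')"
    by simp
  ultimately show "aug_rel (- p) (- p')"
    unfolding aug_rel_def by (simp only: aug_ideal_diff aug_ideal_zero)
qed
lift_definition times_aug_chow :: "'a aug_chow \<Rightarrow> 'a aug_chow \<Rightarrow> 'a aug_chow" is "(*)"
proof -
  fix p p' q q' :: "'a chow_var qpoly"
  assume "aug_rel p p'" "aug_rel q q'"
  moreover have "p * q - p' * q' = p * (q - q') + q' * (p - p')"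
    by (simp add: algebra_simps)
  ultimately show "aug_rel (p * q) (p' * q')"
    unfolding aug_rel_def by (simp add: aug_ideal_add aug_ideal_mult)
qed

lemma aug_rel_refl: "aug_rel p p"
  by (simp add: aug_rel_def aug_ideal_zero)

instance
proof
  fix a b c :: "'a aug_chow"
  show "a * b * c = a * (b * c)" by transfer (simp add: aug_rel_refl mult.assoc)
  show "a * b = b * a" by transfer (simp add: aug_rel_refl mult.commute)
  show "1 * a = a" by transfer (simp add: aug_rel_refl)
  show "a + b + c = a + (b + c)" by transfer (simp add: aug_rel_refl add.assoc)
  show "a + b = b + a" by transfer (simp add: aug_rel_refl add.commute)
  show "0 + a = a" by transfer (simp add: aug_rel_refl)
  show "- a + a = 0" by transfer (simp add: aug_rel_refl)
  show "a - b = a + - b" by transfer (simp add: aug_rel_refl)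
  show "(a + b) * c = a * c + b * c" by transfer (simp add: aug_rel_refl distrib_right)
  show "(0 :: 'a aug_chow) \<noteq> 1"
  proof transfer
    show "\<not> aug_rel 0 (1 :: 'a chow_var qpoly)"
      using aug_ideal_no_const[of "0 - 1 :: 'a chow_var qpoly"]
      by (auto simp: aug_rel_def)
  qed
qed

end

definition aug_scale :: "rat \<Rightarrow> 'n::finite aug_chow \<Rightarrow> 'n aug_chow"
  where "aug_scale c a = aug_class (pconst c) * a"

global_interpretation aug: vector_space "aug_scale :: rat \<Rightarrow> 'n::finite aug_chow \<Rightarrow> 'n aug_chow"
proof
  fix a b :: rat and x y :: "'n aug_chow"
  show "aug_scale a (x + y) = aug_scale a x + aug_scale a y"
    by (simp add: aug_scale_def distrib_left)
  have "aug_class (pconst (a + b)) = aug_class (pconst a) + (aug_class (pconst b) :: 'n aug_chow)"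
    by (simp add: pconst_def single_add plus_aug_chow.abs_eq)
  then show "aug_scale (a + b) x = aug_scale a x + aug_scale b x"
    by (simp add: aug_scale_def distrib_right)
  have "aug_class (pconst (a * b)) = aug_class (pconst a) * (aug_class (pconst b) :: 'n aug_chow)"
    by (simp add: pconst_def mult_single times_aug_chow.abs_eq)
  then show "aug_scale a (aug_scale b x) = aug_scale (a * b) x"
    by (simp add: aug_scale_def mult.assoc)
  have "aug_class (pconst 1) = (1 :: 'n aug_chow)"
    by (simp add: pconst_def one_aug_chow.abs_eq)
  then show "aug_scale 1 x = x"
    by (simp add: aug_scale_def)
qed

definition aug_component :: "nat \<Rightarrow> 'n::finite aug_chow set"
  where "aug_component k = aug_class ` {p. homogeneous k p}"

subsection \<open>The action of the symmetric group\<close>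

definition perm_var :: "'n perm \<Rightarrow> 'n chow_var \<Rightarrow> 'n chow_var"
  where "perm_var \<sigma> v =
    (case v of X F \<Rightarrow> X (Proper (Perm.apply \<sigma> ` elems F)) | Y i \<Rightarrow> Y (Perm.apply \<sigma> i))"

lemma elems_Proper_perm: "elems (Proper (Perm.apply \<sigma> ` elems F)) = Perm.apply \<sigma> ` elems F"
proof -
  have "Perm.apply \<sigma> ` elems F \<noteq> UNIV"
    using elems[of F] bij_apply[of \<sigma>]
    by (metis bij_def inj_image_eq_iff mem_Collect_eq)
  then show ?thesis by (simp add: Proper_inverse)
qed

lemma perm_image_mem: "Perm.apply \<sigma> i \<in> Perm.apply \<sigma> ` A \<longleftrightarrow> i \<in> A"
  using bij_apply[of \<sigma>] by (simp add: bij_def inj_image_mem_iff)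

lemma perm_image_subset: "Perm.apply \<sigma> ` A \<subseteq> Perm.apply \<sigma> ` B \<longleftrightarrow> A \<subseteq> B"
  using bij_apply[of \<sigma>] by (simp add: bij_def inj_image_subset_iff)

lemma perm_proper_bij: "bij (\<lambda>F. Proper (Perm.apply \<sigma> ` elems F))"
proof (rule o_bij[where g = "\<lambda>F. Proper (Perm.apply (inverse \<sigma>) ` elems F)"])
  have *: "(\<lambda>F. Proper (Perm.apply (inverse \<tau>) ` elems F)) \<circ>
      (\<lambda>F. Proper (Perm.apply \<tau> ` elems F)) = id" for \<tau> :: "'a perm"
  proof
    fix F :: "'a proper_subset"
    have "Perm.apply (inverse \<tau>) ` Perm.apply \<tau> ` elems F = elems F"
      using bij_apply[of \<tau>] by (simp add: apply_inverse bij_def image_inv_f_f)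
    then show "((\<lambda>F. Proper (Perm.apply (inverse \<tau>) ` elems F)) \<circ>
      (\<lambda>F. Proper (Perm.apply \<tau> ` elems F))) F = id F"
      by (simp add: elems_Proper_perm elems_inverse)
  qed
  show "(\<lambda>F. Proper (Perm.apply (inverse \<sigma>) ` elems F)) \<circ>
      (\<lambda>F. Proper (Perm.apply \<sigma> ` elems F)) = id"
    by (rule *)
  show "(\<lambda>F. Proper (Perm.apply \<sigma> ` elems F)) \<circ>
      (\<lambda>F. Proper (Perm.apply (inverse \<sigma>) ` elems F)) = id"
    using *[of "inverse \<sigma>"] by simp
qed

lemma aug_gens_invariant:
  assumes "g \<in> aug_gens1 \<union> aug_gens2 \<union> aug_gens3"
  shows "map_vars (perm_var \<sigma>) g \<in> aug_gens1 \<union> aug_gens2 \<union> aug_gens3"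
proof -
  let ?s = "\<lambda>F. Proper (Perm.apply \<sigma> ` elems F)"
  from assms consider "g \<in> aug_gens1" | "g \<in> aug_gens2" | "g \<in> aug_gens3" by blast
  then show ?thesis
  proof cases
    case 1
    then obtain F G where "g = pvar (X F) * pvar (X G)"
      "\<not> elems F \<subseteq> elems G" "\<not> elems G \<subseteq> elems F"
      by (auto simp: aug_gens1_def)
    then have "map_vars (perm_var \<sigma>) g = pvar (X (?s F)) * pvar (X (?s G))"
      "\<not> elems (?s F) \<subseteq> elems (?s G)" "\<not> elems (?s G) \<subseteq> elems (?s F)"
      by (simp_all add: map_vars_mult perm_var_def elems_Proper_perm perm_image_subset)
    then show ?thesis unfolding aug_gens1_def by blast
  next
    case 2
    then obtain i F where "g = pvar (Y i) * pvar (X F)" "i \<notin> elems F"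
      by (auto simp: aug_gens2_def)
    then have "map_vars (perm_var \<sigma>) g = pvar (Y (Perm.apply \<sigma> i)) * pvar (X (?s F))"
      "Perm.apply \<sigma> i \<notin> elems (?s F)"
      by (simp_all add: map_vars_mult perm_var_def elems_Proper_perm perm_image_mem)
    then show ?thesis unfolding aug_gens2_def by blast
  next
    case 3
    then obtain i where g: "g = pvar (Y i) - (\<Sum>F | i \<notin> elems F. pvar (X F))"
      by (auto simp: aug_gens3_def)
    have "bij_betw ?s {F. i \<notin> elems F} {F. Perm.apply \<sigma> i \<notin> elems F}"
    proof (rule bij_betw_imageI)
      show "inj_on ?s {F. i \<notin> elems F}"
        using perm_proper_bij[of \<sigma>] by (meson bij_def inj_on_subset subset_UNIV)
      show "?s ` {F. i \<notin> elems F} = {F. Perm.apply \<sigma> i \<notin> elems F}"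
      proof (intro equalityI subsetI)
        fix F assume "F \<in> ?s ` {F. i \<notin> elems F}"
        then show "F \<in> {F. Perm.apply \<sigma> i \<notin> elems F}"
          by (auto simp: elems_Proper_perm perm_image_mem)
      next
        fix F assume F: "F \<in> {F. Perm.apply \<sigma> i \<notin> elems F}"
        obtain G where G: "F = ?s G"
          using perm_proper_bij[of \<sigma>] unfolding bij_def surj_def by blast
        with F have "i \<notin> elems G"
          by (simp add: elems_Proper_perm perm_image_mem)
        with G show "F \<in> ?s ` {F. i \<notin> elems F}"
          by blast
      qed
    qed
    then have "(\<Sum>F | i \<notin> elems F. pvar (X (?s F)) :: 'a chow_var qpoly)
      = (\<Sum>F | Perm.apply \<sigma> i \<notin> elems F. pvar (X F))"
      by (rule sum.reindex_bij_betw)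
    then have "map_vars (perm_var \<sigma>) g =
      pvar (Y (Perm.apply \<sigma> i)) - (\<Sum>F | Perm.apply \<sigma> i \<notin> elems F. pvar (X F))"
      by (simp add: g map_vars_diff map_vars_sum perm_var_def)
    then show ?thesis unfolding aug_gens3_def by blast
  qed
qed

lemma aug_ideal_invariant:
  assumes "p \<in> aug_ideal"
  shows "map_vars (perm_var \<sigma>) p \<in> aug_ideal"
proof -
  have "module.subspace (*) {q. map_vars (perm_var \<sigma>) q \<in> (aug_ideal :: 'a chow_var qpoly set)}"
    by (rule module.subspaceI[OF module_mult])
      (auto simp: map_vars_add map_vars_mult aug_ideal_zero aug_ideal_add aug_ideal_mult)
  moreover have "aug_gens1 \<union> aug_gens2 \<union> aug_gens3
      \<subseteq> {q. map_vars (perm_var \<sigma>) q \<in> (aug_ideal :: 'a chow_var qpoly set)}"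
    using aug_gens_invariant[of _ \<sigma>]
    by (auto simp: aug_ideal_def ideal_gen_def intro!: module.span_base[OF module_mult])
  ultimately show ?thesis
    using assms module.span_minimal[OF module_mult]
    unfolding aug_ideal_def ideal_gen_def by blast
qed

lift_definition aug_act :: "'n::finite perm \<Rightarrow> 'n aug_chow \<Rightarrow> 'n aug_chow"
  is "\<lambda>\<sigma>. map_vars (perm_var \<sigma>)"
  unfolding aug_rel_def by (metis aug_ideal_invariant map_vars_diff)

definition permutation_basis :: "'n::finite aug_chow set \<Rightarrow> 'n aug_chow set \<Rightarrow> bool"
  where "permutation_basis B W \<longleftrightarrow>
    aug.independent B \<and> aug.span B = W \<and> (\<forall>\<sigma>. aug_act \<sigma> ` B = B)"

subsection \<open>The Feichtner--Yuzvinsky type monomials\<close>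

definition x_elem :: "'n::finite set \<Rightarrow> 'n aug_chow"
  where "x_elem F =
    (if F = UNIV then - (\<Sum>G\<in>UNIV. aug_class (pvar (X G))) else aug_class (pvar (X (Proper F))))"

text \<open>
  A formal monomial \<open>x_{F_1}^{a_1} \<cdots> x_{F_l}^{a_l}\<close> is the list \<open>[(F_1, a_1), \<dots>, (F_l, a_l)]\<close>.
  As the \<open>F_i\<close> increase strictly and the \<open>a_i\<close> are positive, distinct lists in \<open>FY\<close> are
  distinct monomials.  The subtractions on \<^typ>\<open>nat\<close> below do not truncate.
\<close>

definition FY :: "('n::finite set \<times> nat) list set"
  where "FY = {fs.
    sorted_wrt (\<subset>) (map fst fs) \<and>
    (\<forall>i<length fs. fst (fs ! i) \<noteq> {} \<and> 1 \<le> snd (fs ! i)) \<and>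
    (\<forall>i<length fs. snd (fs ! i) \<le>
      (if i = 0 then card (fst (fs ! i))
       else card (fst (fs ! i)) - card (fst (fs ! (i - 1))) - 1))}"

definition FY_deg :: "nat \<Rightarrow> ('n::finite set \<times> nat) list set"
  where "FY_deg k = {fs \<in> FY. sum_list (map snd fs) = k}"

definition fy_class :: "('n::finite set \<times> nat) list \<Rightarrow> 'n aug_chow"
  where "fy_class fs = prod_list (map (\<lambda>(F, a). x_elem F ^ a) fs)"

subsection \<open>The stellahedral fan and its Chow ring\<close>

text \<open>
  The augmented Bergman fan of the Boolean matroid.  Its rays are spanned by the lattice vectors
  \<open>e_i\<close>, with variable \<open>Y i\<close>, and \<open>- (\<Sum>j\<notin>F. e_j)\<close> for \<open>F\<close> proper, with variable \<open>X F\<close>; its cones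
  are spanned by \<open>Y ` I \<union> X ` C\<close> where \<open>C\<close> is a chain of proper flats that contain the
  (independent) set \<open>I\<close>.
\<close>

definition ray :: "'n chow_var \<Rightarrow> 'n \<Rightarrow> int"
  where "ray v j =
    (case v of Y i \<Rightarrow> (if j = i then 1 else 0) | X F \<Rightarrow> (if j \<in> elems F then 0 else - 1))"

definition ray_cone :: "'n::finite chow_var set \<Rightarrow> (real ^ 'n) set"
  where "ray_cone S = convex_cone hull ((\<lambda>v. \<chi> j. of_int (ray v j)) ` S)"

definition stell_fan :: "(real ^ 'n::finite) set set"
  where "stell_fan = {ray_cone (Y ` I \<union> X ` C) | I C.
    (\<forall>F\<in>C. \<forall>G\<in>C. elems F \<subseteq> elems G \<or> elems G \<subseteq> elems F) \<and> (\<forall>F\<in>C. I \<subseteq> elems F)}"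

definition stell_SR_gens :: "'n::finite chow_var qpoly set"
  where "stell_SR_gens = {\<Prod>v\<in>S. pvar v | S. ray_cone S \<notin> stell_fan}"

definition stell_linear_gens :: "'n::finite chow_var qpoly set"
  where "stell_linear_gens =
    {\<Sum>v\<in>UNIV. pconst (of_int (\<Sum>j\<in>UNIV. m j * ray v j)) * pvar v | m. True}"

definition stell_chow_ideal :: "'n::finite chow_var qpoly set"
  where "stell_chow_ideal = ideal_gen (stell_SR_gens \<union> stell_linear_gens)"

end

theory Submission
  imports Defs "HOL-Library.Function_Algebras"
begin

text \<open>
  Put \<open>z_i = \<Sum>{x_F | i \<in> F} = - y_i\<close> and \<open>h_G = \<Sum>{x_F | G \<subseteq> F}\<close>, where \<open>F = [n]\<close> is included.  The
  defining relations give \<open>x_F z_i = 0\<close> for \<open>i \<notin> F\<close> and \<open>z_i\<^sup>2 = 0\<close>, and from these one gets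
  \<open>x_F h_G^|G - F| = 0\<close> if \<open>G\<close> is not contained in \<open>F\<close>, and \<open>h_G^(|G| + 1) = 0\<close>.  They rewrite every
  monomial outside \<open>FY\<close> into monomials with larger \<open>\<Sum>|F_i|\<close>, so \<open>FY\<close> spans.

  For independence, deform the linear relations to \<open>y_i - \<Sum>{x_F | i \<notin> F} = t_i\<close> with \<open>t\<close> generic.
  Together with the quadratic monomial relations these cut out one point for each maximal cone of
  the fan, i.e. for each list of distinct elements of \<open>[n]\<close>.  By induction on the degree, a
  homogeneous spanning set of the Chow ring spans all functions on these points, so it has at
  least as many elements as there are points, and \<open>FY\<close> has exactly that many.
\<close>

subsection \<open>Relations in the augmented Chow ring\<close>

lemma aug_class_simps:
  "aug_class 0 = 0" "aug_class 1 = 1"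
  "aug_class (p + q) = aug_class p + aug_class q"
  "aug_class (p - q) = aug_class p - aug_class q"
  "aug_class (- p) = - aug_class p"
  "aug_class (p * q) = aug_class p * aug_class q"
  by (simp_all add: zero_aug_chow.abs_eq one_aug_chow.abs_eq plus_aug_chow.abs_eq
      minus_aug_chow.abs_eq uminus_aug_chow.abs_eq times_aug_chow.abs_eq)

lemma aug_class_sum: "aug_class (\<Sum>x\<in>A. f x) = (\<Sum>x\<in>A. aug_class (f x))"
  by (induction A rule: infinite_finite_induct) (simp_all add: aug_class_simps)

lemma aug_class_power: "aug_class (p ^ k) = aug_class p ^ k"
  by (induction k) (simp_all add: aug_class_simps)

lemma aug_class_eq_iff: "aug_class p = aug_class q \<longleftrightarrow> p - q \<in> aug_ideal"
  by (simp add: aug_chow.abs_eq_iff aug_rel_def)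

lemma aug_class_eq_0_iff: "aug_class p = 0 \<longleftrightarrow> p \<in> aug_ideal"
  using aug_class_eq_iff[of p 0] by (simp add: aug_class_simps)

lemma aug_gens_subset_ideal: "aug_gens1 \<union> aug_gens2 \<union> aug_gens3 \<subseteq> aug_ideal"
  unfolding aug_ideal_def ideal_gen_def by (rule module.span_superset[OF module_mult])

lemma aug_scale_class: "aug_scale c (aug_class p) = aug_class (pconst c * p)"
  by (simp add: aug_scale_def aug_class_simps)

lemma aug_scale_mult_left: "aug_scale c a * b = aug_scale c (a * b)"
  by (simp add: aug_scale_def mult.assoc)

lemma aug_scale_mult_right: "b * aug_scale c a = aug_scale c (b * a)"
  by (simp add: aug_scale_def mult_ac)

lemma x_elem_elems: "x_elem (elems F) = aug_class (pvar (X F))"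
  using elems[of F] by (simp add: x_elem_def elems_inverse)

lemma range_elems: "range elems = UNIV - {UNIV}"
proof -
  have "F \<in> range elems" if "F \<noteq> UNIV" for F :: "'a set"
    using that Proper_inverse[of F] by (metis (mono_tags) mem_Collect_eq rangeI)
  then show ?thesis using elems by auto
qed

lemma sum_over_proper: "(\<Sum>F | P (elems F). g (elems F)) = (\<Sum>F | F \<noteq> UNIV \<and> P F. g F)"
proof (rule sum.reindex_bij_betw)
  show "bij_betw elems {F. P (elems F)} {F. F \<noteq> UNIV \<and> P F}"
  proof (rule bij_betw_imageI)
    show "inj_on elems {F. P (elems F)}" by (simp add: inj_on_def elems_inject)
    show "elems ` {F. P (elems F)} = {F. F \<noteq> UNIV \<and> P F}"
    proof (intro equalityI subsetI)
      fix F assume F: "F \<in> {F. F \<noteq> UNIV \<and> P F}"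
      then have "F \<in> range elems" using range_elems by blast
      with F show "F \<in> elems ` {F. P (elems F)}" by blast
    qed (use elems in auto)
  qed
qed

lemma sum_x_elem_eq_0: "(\<Sum>F\<in>UNIV. x_elem F) = 0"
proof -
  have "(\<Sum>F\<in>UNIV. x_elem F) = x_elem UNIV + (\<Sum>F | F \<noteq> (UNIV :: 'a set). x_elem F)"
    by (subst sum.remove[of _ UNIV]) (auto intro!: sum.cong)
  also have "(\<Sum>F | F \<noteq> (UNIV :: 'a set). x_elem F) = (\<Sum>G\<in>UNIV. aug_class (pvar (X G)))"
    using sum_over_proper[where P = "\<lambda>_. True" and g = x_elem, symmetric] by (simp add: x_elem_elems)
  finally show ?thesis by (simp add: x_elem_def)
qed

lemma x_elem_mult_incomparable:
  assumes "\<not> F \<subseteq> G" "\<not> G \<subseteq> F"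
  shows "x_elem F * x_elem G = 0"
proof -
  obtain F' G' where F': "F = elems F'" and G': "G = elems G'"
    using assms range_elems by (metis DiffI UNIV_I image_iff singletonD top_greatest)
  have "pvar (X F') * pvar (X G') \<in> aug_gens1"
    using assms unfolding aug_gens1_def F' G' by blast
  then have "pvar (X F') * pvar (X G') \<in> aug_ideal" using aug_gens_subset_ideal by blast
  then show ?thesis unfolding F' G' x_elem_elems
    by (simp flip: aug_class_simps(6) add: aug_class_eq_0_iff)
qed

definition z_elem :: "'n::finite \<Rightarrow> 'n aug_chow"
  where "z_elem i = (\<Sum>F | i \<in> F. x_elem F)"

lemma z_elem_eq_minus_sum: "z_elem i = - (\<Sum>F | i \<notin> F. x_elem F)"
proof -
  have "UNIV = {F. i \<in> F} \<union> {F. i \<notin> F}" by auto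
  then have "(\<Sum>F\<in>UNIV. x_elem F) = z_elem i + (\<Sum>F | i \<notin> F. x_elem F)"
    unfolding z_elem_def by (subst sum.union_disjoint[symmetric]) auto
  then show ?thesis by (simp add: sum_x_elem_eq_0 eq_neg_iff_add_eq_0)
qed

lemma aug_class_Y: "aug_class (pvar (Y i)) = - z_elem i"
proof -
  have "pvar (Y i) - (\<Sum>F | i \<notin> elems F. pvar (X F)) \<in> aug_ideal"
    using aug_gens_subset_ideal unfolding aug_gens3_def by blast
  then have "aug_class (pvar (Y i)) = (\<Sum>F | i \<notin> elems F. aug_class (pvar (X F)))"
    by (simp flip: aug_class_sum add: aug_class_eq_iff)
  also have "\<dots> = (\<Sum>F | F \<noteq> UNIV \<and> i \<notin> F. x_elem F)"
    using sum_over_proper[where P = "\<lambda>F. i \<notin> F" and g = x_elem] by (simp add: x_elem_elems)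
  also have "\<dots> = (\<Sum>F | i \<notin> F. x_elem F)"
    by (rule sum.cong) auto
  finally show ?thesis by (simp add: z_elem_eq_minus_sum)
qed

text \<open>This is the relation y_i x_F = 0 with y_i replaced by - z_i, as
  \<open>aug_class_Y\<close> permits.\<close>

lemma x_elem_mult_z_elem:
  assumes "i \<notin> F"
  shows "x_elem F * z_elem i = 0"
proof -
  obtain F' where F': "F = elems F'"
    using assms range_elems by (metis DiffI UNIV_I image_iff singletonD)
  have "pvar (Y i) * pvar (X F') \<in> aug_ideal"
    using aug_gens_subset_ideal assms unfolding aug_gens2_def F' by blast
  then have "aug_class (pvar (Y i)) * x_elem F = 0"
    unfolding F' x_elem_elems by (simp flip: aug_class_simps(6) add: aug_class_eq_0_iff)
  then show ?thesis by (simp add: aug_class_Y mult.commute)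
qed

text \<open>All x_F together sum to 0, so one factor z_i is minus the sum of the x_F with i not in
  F, and each of these kills the other factor.\<close>

lemma z_elem_square: "z_elem i * z_elem i = 0"
proof -
  have "z_elem i * z_elem i = - (\<Sum>F | i \<notin> F. x_elem F * z_elem i)"
    by (subst (1) z_elem_eq_minus_sum) (simp add: sum_distrib_right)
  also have "\<dots> = 0" by (simp add: x_elem_mult_z_elem)
  finally show ?thesis .
qed

definition h_elem :: "'n::finite set \<Rightarrow> 'n aug_chow"
  where "h_elem G = (\<Sum>F | G \<subseteq> F. x_elem F)"

text \<open>Used to trade one factor h_G for z_i, at the cost of terms x_H with i in H but G not
  contained in H. Suitable powers of h_G kill those terms.\<close>

lemma h_elem_eq:
  assumes "i \<in> G"
  shows "h_elem G = z_elem i - (\<Sum>H | i \<in> H \<and> \<not> G \<subseteq> H. x_elem H)"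
proof -
  have "{H. i \<in> H} = {H. G \<subseteq> H} \<union> {H. i \<in> H \<and> \<not> G \<subseteq> H}" using assms by auto
  then have "z_elem i = h_elem G + (\<Sum>H | i \<in> H \<and> \<not> G \<subseteq> H. x_elem H)"
    unfolding z_elem_def h_elem_def by (subst sum.union_disjoint[symmetric]) auto
  then show ?thesis by simp
qed

lemma mult_power_eq_0_mono: "(x :: 'a::comm_ring_1) * y ^ a = 0 \<Longrightarrow> a \<le> b \<Longrightarrow> x * y ^ b = 0"
  by (metis le_add_diff_inverse mult.assoc mult_zero_left power_add)

text \<open>Induction on |G - F|. Pick i in G - F and expand one factor h_G by
  \<open>h_elem_eq\<close>. The term x_F z_i vanishes. As i lies in H but not in F, x_F x_H vanishes
  unless F is contained in H, and then G - H is strictly smaller than G - F, so the remaining |G -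
  F| - 1 factors h_G kill x_H.\<close>

lemma x_elem_mult_h_elem_power:
  "\<not> G \<subseteq> F \<Longrightarrow> x_elem F * h_elem G ^ card (G - F) = 0"
proof (induction "card (G - F)" arbitrary: F rule: less_induct)
  case less
  then obtain i where i: "i \<in> G" "i \<notin> F" by blast
  then have "card (G - F) \<noteq> 0" by auto
  then obtain e where e: "card (G - F) = Suc e" using not0_implies_Suc by blast
  have 0: "x_elem F * h_elem G ^ e * x_elem H = 0" if H: "i \<in> H" "\<not> G \<subseteq> H" for H
  proof (cases "F \<subseteq> H")
    case True
    then have "card (G - H) < card (G - F)"
      using i H by (intro psubset_card_mono) auto
    with less.hyps H e have "x_elem H * h_elem G ^ e = 0"
      by (metis less_Suc_eq_le mult_power_eq_0_mono)
    then show ?thesis by (simp add: mult_ac)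
  next
    case False
    then have "x_elem F * x_elem H = 0"
      using i H x_elem_mult_incomparable by blast
    then show ?thesis by (metis mult.assoc mult.commute mult_zero_left)
  qed
  have "x_elem F * h_elem G ^ card (G - F) = x_elem F * h_elem G ^ e * h_elem G"
    by (simp add: e mult_ac)
  also have "\<dots> = x_elem F * z_elem i * h_elem G ^ e
      - (\<Sum>H | i \<in> H \<and> \<not> G \<subseteq> H. x_elem F * h_elem G ^ e * x_elem H)"
    by (subst (2) h_elem_eq[OF i(1)]) (simp add: right_diff_distrib sum_distrib_left mult_ac)
  also have "\<dots> = 0" using 0 i(2) by (simp add: x_elem_mult_z_elem)
  finally show ?case .
qed

text \<open>Fix i in G. The error terms x_H in \<open>h_elem_eq\<close> have |G - H| < |G|, hence
  are killed by h_G^(|G| - 1). In the presence of this power, each of the two further factors h_G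
  may be replaced by z_i, and z_i squared is 0.\<close>

lemma h_elem_power_eq_0:
  assumes "G \<noteq> {}"
  shows "h_elem G ^ Suc (card G) = 0"
proof -
  obtain i where i: "i \<in> G" using assms by blast
  then have "card G \<noteq> 0" by auto
  then obtain e where e: "card G = Suc e" using not0_implies_Suc by blast
  have 0: "x_elem H * h_elem G ^ e = 0" if H: "i \<in> H" "\<not> G \<subseteq> H" for H
  proof (rule mult_power_eq_0_mono)
    show "x_elem H * h_elem G ^ card (G - H) = 0" using H x_elem_mult_h_elem_power by blast
    have "card (G - H) < card G" using i H by (intro psubset_card_mono) auto
    then show "card (G - H) \<le> e" using e by simp
  qed
  have step: "h_elem G ^ e * h_elem G = h_elem G ^ e * z_elem i"
    by (subst (2) h_elem_eq[OF i]) (simp add: right_diff_distrib sum_distrib_left 0 mult.commute)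
  have "h_elem G ^ Suc (card G) = h_elem G ^ e * h_elem G * h_elem G"
    by (simp add: e mult_ac)
  also have "\<dots> = h_elem G ^ e * h_elem G * z_elem i"
    by (metis step mult.assoc mult.commute)
  also have "\<dots> = h_elem G ^ e * (z_elem i * z_elem i)"
    by (simp only: step mult.assoc)
  finally show ?thesis by (simp add: z_elem_square)
qed

subsection \<open>Spanning by straightening\<close>

lemma aug_span_mult:
  assumes "a \<in> aug.span A" "b \<in> aug.span B"
    and "\<And>x y. x \<in> A \<Longrightarrow> y \<in> B \<Longrightarrow> x * y \<in> aug.span C"
  shows "a * b \<in> aug.span C"
  using assms(1)
proof (induction rule: aug.span_induct_alt)
  case base
  then show ?case by (simp add: aug.span_zero)
next
  case (step c x a)
  have "x * b \<in> aug.span C"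
    using assms(2)
  proof (induction rule: aug.span_induct_alt)
    case base
    then show ?case by (simp add: aug.span_zero)
  next
    case (step d y b)
    then show ?case using assms(3) \<open>x \<in> A\<close>
      by (simp add: distrib_left aug_scale_mult_right aug.span_add aug.span_scale)
  qed
  with step show ?case
    by (simp add: distrib_right aug_scale_mult_left aug.span_add aug.span_scale)
qed

section \<open>Monomials in the \<open>x_F\<close> and their filtration by weight\<close>

definition x_mon :: "'n::finite set multiset \<Rightarrow> 'n aug_chow"
  where "x_mon M = (\<Prod>F\<in>#M. x_elem F)"

definition x_span :: "nat \<Rightarrow> nat \<Rightarrow> 'n::finite aug_chow set"
  where "x_span k w =
    aug.span (x_mon ` {M. {} \<notin># M \<and> size M = k \<and> w \<le> (\<Sum>F\<in>#M. card F)})"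

lemma x_mon_simps:
  "x_mon {#} = 1" "x_mon (add_mset F M) = x_elem F * x_mon M" "x_mon (M + N) = x_mon M * x_mon N"
  "x_mon (replicate_mset d G) = x_elem G ^ d"
  by (simp_all add: x_mon_def)

lemma x_mon_in_x_span:
  "{} \<notin># M \<Longrightarrow> size M = k \<Longrightarrow> w \<le> (\<Sum>F\<in>#M. card F) \<Longrightarrow> x_mon M \<in> x_span k w"
  unfolding x_span_def by (rule aug.span_base) auto

lemma x_elem_in_x_span: "F \<noteq> {} \<Longrightarrow> w \<le> card F \<Longrightarrow> x_elem F \<in> x_span (Suc 0) w"
  using x_mon_in_x_span[of "{#F#}" 1 w] by (simp add: x_mon_def)

lemma sum_x_elem_in_x_span:
  assumes "\<And>F. F \<in> A \<Longrightarrow> F \<noteq> {} \<and> w \<le> card F"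
  shows "(\<Sum>F\<in>A. x_elem F) \<in> x_span (Suc 0) w"
  using assms x_elem_in_x_span unfolding x_span_def by (blast intro: aug.span_sum)

lemma x_elem_power_in_x_span: "F \<noteq> {} \<Longrightarrow> x_elem F ^ d \<in> x_span d (d * card F)"
  using x_mon_in_x_span[of "replicate_mset d F" d "d * card F"] by (simp add: x_mon_simps)

lemma x_span_mult:
  assumes "a \<in> x_span j v" "b \<in> x_span k w"
  shows "a * b \<in> x_span (j + k) (v + w)"
  using assms unfolding x_span_def
proof (rule aug_span_mult)
  fix x y :: "'a aug_chow"
  assume "x \<in> x_mon ` {M. {} \<notin># M \<and> size M = j \<and> v \<le> (\<Sum>F\<in>#M. card F)}"
    "y \<in> x_mon ` {M. {} \<notin># M \<and> size M = k \<and> w \<le> (\<Sum>F\<in>#M. card F)}"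
  then show "x * y \<in> aug.span
      (x_mon ` {M. {} \<notin># M \<and> size M = j + k \<and> v + w \<le> (\<Sum>F\<in>#M. card F)})"
    by (auto simp flip: x_mon_simps(3) intro!: aug.span_base imageI)
qed

text \<open>Among the x_F occurring in h_G, x_G is the only one of weight |G|, all others being
  heavier. Thus x_G^d is the lowest-weight term of h_G^d, and a relation containing h_G^d can be
  solved for x_G^d modulo heavier monomials.\<close>

lemma h_elem_power_diff_in_x_span:
  assumes G: "G \<noteq> {}"
  shows "h_elem G ^ d - x_elem G ^ d \<in> x_span d (Suc (d * card G))"
proof (induction d)
  case 0
  then show ?case by (simp add: x_span_def aug.span_zero)
next
  case (Suc d)
  have h: "h_elem G \<in> x_span (Suc 0) (card G)"
    unfolding h_elem_def using G by (intro sum_x_elem_in_x_span) (auto intro: card_mono)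
  have "{F. G \<subseteq> F} = insert G {F. G \<subset> F}" by auto
  then have "h_elem G - x_elem G = (\<Sum>F | G \<subset> F. x_elem F)"
    unfolding h_elem_def by (subst (1) \<open>{F. G \<subseteq> F} = _\<close>) simp
  also have "\<dots> \<in> x_span (Suc 0) (Suc (card G))"
    using G by (intro sum_x_elem_in_x_span) (auto simp: Suc_le_eq intro: psubset_card_mono)
  finally have hx: "h_elem G - x_elem G \<in> x_span (Suc 0) (Suc (card G))" .
  have "h_elem G ^ Suc d - x_elem G ^ Suc d =
      h_elem G * (h_elem G ^ d - x_elem G ^ d) + (h_elem G - x_elem G) * x_elem G ^ d"
    by (simp add: algebra_simps)
  moreover have "h_elem G * (h_elem G ^ d - x_elem G ^ d) \<in> x_span (Suc d) (Suc (Suc d * card G))"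
    using x_span_mult[OF h Suc] by simp
  moreover have "(h_elem G - x_elem G) * x_elem G ^ d \<in> x_span (Suc d) (Suc (Suc d * card G))"
    using x_span_mult[OF hx x_elem_power_in_x_span[OF G, of d]] by simp
  ultimately show ?case by (simp add: x_span_def aug.span_add)
qed

lemma finite_chain_sorted_list:
  assumes "finite C" "\<And>F G. F \<in> C \<Longrightarrow> G \<in> C \<Longrightarrow> F \<subseteq> G \<or> G \<subseteq> F"
  shows "\<exists>xs. sorted_wrt (\<subset>) xs \<and> set xs = C"
  using assms
proof (induction C rule: finite_psubset_induct)
  case (psubset C)
  show ?case
  proof (cases "C = {}")
    case False
    then obtain m where m: "m \<in> C" "\<And>F. F \<in> C \<Longrightarrow> m \<subseteq> F \<Longrightarrow> m = F"
      using finite_has_maximal[OF psubset.hyps] by blast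
    obtain xs where xs: "sorted_wrt (\<subset>) xs" "set xs = C - {m}"
      using psubset.IH[of "C - {m}"] psubset.prems m(1) by blast
    have "F \<subset> m" if "F \<in> C - {m}" for F
      using that m psubset.prems[of F m] by blast
    then have "sorted_wrt (\<subset>) (xs @ [m]) \<and> set (xs @ [m]) = C"
      using xs m(1) by (auto simp: sorted_wrt_append)
    then show ?thesis by blast
  qed auto
qed

lemma sorted_wrt_psubset_distinct: "sorted_wrt (\<subset>) xs \<Longrightarrow> distinct xs"
  by (induction xs) auto

text \<open>The support is a chain, so it can be listed in increasing order with the multiplicities
  as exponents. The strict inequality in \<open>gap\<close>, applied to consecutive sets, becomes
  the bound |F_i| - |F_(i-1)| - 1 of \<open>FY\<close>.\<close>

lemma reduced_x_mon:
  assumes ne: "{} \<notin># M"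
    and chain: "\<And>F G. F \<in># M \<Longrightarrow> G \<in># M \<Longrightarrow> F \<subseteq> G \<or> G \<subseteq> F"
    and bound: "\<And>G. G \<in># M \<Longrightarrow> count M G \<le> card G"
    and gap: "\<And>F G. F \<in># M \<Longrightarrow> G \<in># M \<Longrightarrow> F \<subset> G \<Longrightarrow> count M G < card (G - F)"
  shows "x_mon M \<in> fy_class ` FY_deg (size M)"
proof -
  obtain xs where xs: "sorted_wrt (\<subset>) xs" "set xs = set_mset M"
    using finite_chain_sorted_list[of "set_mset M"] chain by auto
  then have dist: "distinct xs" by (simp add: sorted_wrt_psubset_distinct)
  define fs where "fs = map (\<lambda>F. (F, count M F)) xs"
  have mem: "xs ! i \<in># M" if "i < length xs" for i
    using that xs(2) nth_mem by blast
  have "fs \<in> FY"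
    unfolding FY_def
  proof (safe)
    show "sorted_wrt (\<subset>) (map fst fs)" using xs(1) by (simp add: fs_def comp_def)
  next
    fix i assume "i < length fs" "fst (fs ! i) = {}"
    then show False using ne mem[of i] by (simp add: fs_def)
  next
    fix i assume "i < length fs"
    then show "1 \<le> snd (fs ! i)" using mem[of i] by (simp add: fs_def Suc_le_eq)
  next
    fix i assume i: "i < length fs"
    show "snd (fs ! i) \<le> (if i = 0 then card (fst (fs ! i))
       else card (fst (fs ! i)) - card (fst (fs ! (i - 1))) - 1)"
    proof (cases "i = 0")
      case True
      with i show ?thesis using bound[OF mem[of i]] by (simp add: fs_def)
    next
      case False
      then have lt: "xs ! (i - 1) \<subset> xs ! i"
        using i sorted_wrt_nth_less[OF xs(1), of "i - 1" i] by (simp add: fs_def)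
      have "count M (xs ! i) < card (xs ! i - xs ! (i - 1))"
        using gap[OF _ _ lt] mem i by (simp add: fs_def)
      also have "\<dots> = card (xs ! i) - card (xs ! (i - 1))"
        using lt by (simp add: card_Diff_subset)
      finally show ?thesis using False i by (simp add: fs_def)
    qed
  qed
  moreover have "sum_list (map snd fs) = size M"
    using dist xs(2) by (simp add: fs_def comp_def sum_list_distinct_conv_sum_set size_multiset_overloaded_eq)
  moreover have "fy_class fs = x_mon M"
    using dist xs(2)
    by (simp add: fs_def fy_class_def x_mon_def comp_def prod.distinct_set_conv_list[symmetric]
        image_prod_mset_multiplicity)
  ultimately show ?thesis unfolding FY_deg_def by force
qed

text \<open>This ceiling on the weight in a given degree makes straightening terminate.\<close>

lemma sum_card_le: "(\<Sum>F\<in>#M. card F) \<le> size M * CARD('n)" for M :: "'n::finite set multiset"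
proof (induction M)
  case (add F M)
  then show ?case using card_mono[of UNIV F] by simp
qed simp

lemma mset_split_count:
  assumes "d \<le> count M G"
  obtains N where "M = N + replicate_mset d G"
  using assms by (metis count_le_replicate_mset_subset_eq subset_mset.diff_add)

text \<open>Induction on the distance of the weight from its maximum. By
  \<open>reduced_x_mon\<close>, a monomial not yet in \<open>FY\<close> contains two incomparable
  sets, and is then 0, or a factor x_G^(|G| + 1), or a factor x_F x_G^|G - F| with F strictly inside
  G. In the last two cases a relation for powers of h_G replaces it by heavier monomials of the same
  degree.\<close>

lemma x_mon_in_span_FY:
  fixes M :: "'n::finite set multiset"
  assumes "{} \<notin># M"
  shows "x_mon M \<in> aug.span (fy_class ` FY_deg (size M))"
  using assms
proof (induction "size M * CARD('n) - (\<Sum>F\<in>#M. card F)" arbitrary: M rule: less_induct)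
  case less
  let ?w = "\<lambda>M :: 'n set multiset. \<Sum>F\<in>#M. card F"
  let ?S = "aug.span (fy_class ` FY_deg (size M)) :: 'n aug_chow set"
  have "x_mon M' \<in> ?S" if M': "{} \<notin># M'" "size M' = size M" "Suc (?w M) \<le> ?w M'" for M'
    using less.hyps[of M'] M' sum_card_le[of M'] by fastforce
  then have higher: "x_span (size M) (Suc (?w M)) \<subseteq> ?S"
    unfolding x_span_def by (intro aug.span_minimal) (auto intro: aug.subspace_span)
  text \<open>A relation \<open>p * h_elem G ^ d = 0\<close> rewrites \<open>p * x_elem G ^ d\<close> to heavier monomials.\<close>
  have rewrite: "x_mon M \<in> ?S"
    if M: "M = N + replicate_mset d G" and "G \<noteq> {}" and 0: "x_mon N * h_elem G ^ d = 0" for N d G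
  proof -
    have N: "x_mon N \<in> x_span (size N) (?w N)"
      using less.prems M by (intro x_mon_in_x_span) auto
    have "?w (replicate_mset d G) = d * card G" by (induction d) auto
    then have "x_mon N * (h_elem G ^ d - x_elem G ^ d) \<in> x_span (size M) (Suc (?w M))"
      using x_span_mult[OF N h_elem_power_diff_in_x_span[OF \<open>G \<noteq> {}\<close>, of d]] by (simp add: M)
    then have "x_mon N * (h_elem G ^ d - x_elem G ^ d) \<in> ?S" using higher by blast
    then have "- (x_mon N * (h_elem G ^ d - x_elem G ^ d)) \<in> ?S" by (rule aug.span_neg)
    then show ?thesis by (simp add: M x_mon_simps right_diff_distrib 0)
  qed
  consider (incomparable) F G where "F \<in># M" "G \<in># M" "\<not> F \<subseteq> G" "\<not> G \<subseteq> F"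
    | (bound) G where "G \<in># M" "Suc (card G) \<le> count M G"
    | (gap) F G where "F \<in># M" "G \<in># M" "F \<subset> G" "card (G - F) \<le> count M G"
    | (reduced) "x_mon M \<in> fy_class ` FY_deg (size M)"
  proof (cases "x_mon M \<in> fy_class ` FY_deg (size M)")
    case False
    have "\<not> ((\<forall>F\<in>#M. \<forall>G\<in>#M. F \<subseteq> G \<or> G \<subseteq> F) \<and> (\<forall>G\<in>#M. count M G \<le> card G) \<and>
        (\<forall>F\<in>#M. \<forall>G\<in>#M. F \<subset> G \<longrightarrow> count M G < card (G - F)))" (is "\<not> ?P")
    proof
      assume ?P
      then have "x_mon M \<in> fy_class ` FY_deg (size M)"
        by (intro reduced_x_mon[OF less.prems]) simp_all
      with False show False by contradiction
    qed
    then consider "\<exists>F\<in>#M. \<exists>G\<in>#M. \<not> (F \<subseteq> G \<or> G \<subseteq> F)"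
      | "\<exists>G\<in>#M. \<not> count M G \<le> card G"
      | "\<exists>F\<in>#M. \<exists>G\<in>#M. F \<subset> G \<and> \<not> count M G < card (G - F)"
      by meson
    then show thesis
    proof cases
      case 1
      then show thesis using incomparable by blast
    next
      case 2
      then show thesis using bound by (auto simp: not_le Suc_le_eq)
    next
      case 3
      then obtain F G where "F \<in># M" "G \<in># M" "F \<subset> G" "\<not> count M G < card (G - F)" by blast
      then show thesis by (intro gap[of F G]) simp_all
    qed
  qed (rule that)
  then show ?case
  proof cases
    case incomparable
    then obtain N1 where N1: "M = add_mset F N1" by (metis mset_add)
    with incomparable have "G \<in># N1" by auto
    then obtain N where "N1 = add_mset G N" by (metis mset_add)
    with N1 have "x_mon M = x_elem F * x_elem G * x_mon N" by (simp add: x_mon_simps mult_ac)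
    with incomparable show ?thesis by (simp add: x_elem_mult_incomparable aug.span_zero)
  next
    case bound
    then obtain N where N: "M = N + replicate_mset (Suc (card G)) G" by (metis mset_split_count)
    have "G \<noteq> {}" using bound less.prems by blast
    then show ?thesis
      by (rule rewrite[OF N]) (simp only: h_elem_power_eq_0[OF \<open>G \<noteq> {}\<close>] mult_zero_right)
  next
    case gap
    then obtain N where N: "M = N + replicate_mset (card (G - F)) G" by (metis mset_split_count)
    \<comment> \<open>Only copies of G were split off, and F differs from G, so F stays in the
      remaining factor.\<close>
    have "F \<in># N" using gap N by (auto split: if_splits)
    then obtain N' where "N = add_mset F N'" by (metis insert_DiffM)
    then have "x_mon N * h_elem G ^ card (G - F) = x_mon N' * (x_elem F * h_elem G ^ card (G - F))"
      by (simp add: x_mon_simps mult_ac)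
    also have "\<dots> = 0" using gap x_elem_mult_h_elem_power[of G F] by auto
    finally show ?thesis using rewrite[OF N] gap less.prems by blast
  next
    case reduced
    then show ?thesis by (rule aug.span_base)
  qed
qed

section \<open>From monomials in the \<open>x_F\<close> to arbitrary homogeneous polynomials\<close>

lemma aug_class_pvar_in_x_span: "aug_class (pvar v) \<in> x_span (Suc 0) 0"
proof -
  have sum: "(\<Sum>F\<in>A. x_elem F) \<in> x_span (Suc 0) 0" if "{} \<notin> A" for A :: "'a set set"
    using that by (intro sum_x_elem_in_x_span) auto
  have neg: "- a \<in> x_span (Suc 0) 0" if "a \<in> x_span (Suc 0) 0" for a :: "'a aug_chow"
    using that by (simp add: x_span_def aug.span_neg)
  have x: "x_elem F \<in> x_span (Suc 0) 0" for F :: "'a set"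
  proof (cases "F = {}")
    case True
    \<comment> \<open>The variable x_{} is excluded from \<open>x_span\<close>; it is recovered from
      the others because all x_F sum to 0.\<close>
    have "(\<Sum>F\<in>UNIV. x_elem F) = x_elem F + (\<Sum>G\<in>UNIV - {F}. x_elem G)"
      by (subst sum.remove[of _ F]) auto
    then have "x_elem F = - (\<Sum>G\<in>UNIV - {F}. x_elem G)"
      by (simp add: sum_x_elem_eq_0 eq_neg_iff_add_eq_0)
    then show ?thesis using True by (simp only:) (intro neg sum, simp)
  qed (simp add: x_elem_in_x_span)
  show ?thesis
  proof (cases v)
    case (X F)
    then show ?thesis using x[of "elems F"] by (simp add: x_elem_elems)
  next
    case (Y i)
    \<comment> \<open>Every set occurring in z_i contains i, hence is nonempty.\<close>
    then show ?thesis by (auto simp: aug_class_Y z_elem_def intro!: neg sum)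
  qed
qed

lemma x_span_power:
  assumes "a \<in> x_span (Suc 0) 0"
  shows "a ^ k \<in> x_span k 0"
proof (induction k)
  case 0
  then show ?case using x_mon_in_x_span[of "{#}" 0 0] by (simp add: x_mon_simps)
next
  case (Suc k)
  then show ?case using x_span_mult[OF assms Suc] by simp
qed

lemma mon_degree_UNIV: "mon_degree m = (\<Sum>v\<in>UNIV. Poly_Mapping.lookup m v)"
  for m :: "'v::finite \<Rightarrow>\<^sub>0 nat"
  unfolding mon_degree_def by (rule sum.mono_neutral_left) (auto simp: in_keys_iff)

lemma mon_degree_add: "mon_degree (m + m') = mon_degree m + mon_degree m'"
  for m :: "'v::finite \<Rightarrow>\<^sub>0 nat"
  by (simp add: mon_degree_UNIV lookup_add sum.distrib)

lemma monomial_eq_prod_pvar: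
  fixes m :: "'v::finite \<Rightarrow>\<^sub>0 nat"
  shows "Poly_Mapping.single m (1 :: rat) = (\<Prod>v\<in>UNIV. pvar v ^ Poly_Mapping.lookup m v)"
proof -
  have pow: "pvar v ^ k = Poly_Mapping.single (Poly_Mapping.single v k) 1" for v :: 'v and k
    by (induction k) (simp_all add: pvar_def mult_single flip: single_add)
  have "(\<Prod>v\<in>A. pvar v ^ Poly_Mapping.lookup m v) =
      Poly_Mapping.single (\<Sum>v\<in>A. Poly_Mapping.single v (Poly_Mapping.lookup m v)) (1 :: rat)" for A :: "'v set"
    by (induction A rule: infinite_finite_induct) (simp_all add: pow mult_single)
  moreover have "(\<Sum>v\<in>UNIV. Poly_Mapping.single v (Poly_Mapping.lookup m v)) = m"
    by (rule poly_mapping_eqI) (simp add: lookup_sum lookup_single when_def)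
  ultimately show ?thesis by metis
qed

lemma aug_class_homogeneous_in_span_FY:
  fixes p :: "'n::finite chow_var qpoly"
  assumes "homogeneous k p"
  shows "aug_class p \<in> aug.span (fy_class ` FY_deg k)"
proof -
  have sub: "x_span j 0 \<subseteq> aug.span (fy_class ` FY_deg j :: 'n aug_chow set)" for j
    unfolding x_span_def using x_mon_in_span_FY
    by (intro aug.span_minimal) (auto intro: aug.subspace_span)
  have "(\<Prod>v\<in>A. aug_class (pvar v) ^ Poly_Mapping.lookup m v)
      \<in> x_span (\<Sum>v\<in>A. Poly_Mapping.lookup m v) 0" for m and A :: "'n chow_var set"
  proof (induction A rule: infinite_finite_induct)
    case (insert v A)
    then show ?case
      using x_span_mult[OF x_span_power[OF aug_class_pvar_in_x_span[of v]] insert.IH] by simp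
  qed (use x_span_power[of _ 0] aug_class_pvar_in_x_span in auto)
  moreover have "aug_class (\<Prod>v\<in>A. f v) = (\<Prod>v\<in>A. aug_class (f v))"
    for A :: "'n chow_var set" and f :: "_ \<Rightarrow> 'n chow_var qpoly"
    by (induction A rule: infinite_finite_induct) (simp_all add: aug_class_simps)
  ultimately have mon: "aug_class (Poly_Mapping.single m 1) \<in> x_span (mon_degree m) 0"
    for m :: "'n chow_var \<Rightarrow>\<^sub>0 nat"
    by (simp add: monomial_eq_prod_pvar aug_class_power mon_degree_UNIV)
  have "aug_class (Poly_Mapping.single m c) = aug_scale c (aug_class (Poly_Mapping.single m 1))"
    for m :: "'n chow_var \<Rightarrow>\<^sub>0 nat" and c
    by (simp add: aug_scale_class pconst_def mult_single)
  then have "aug_class p = (\<Sum>m\<in>Poly_Mapping.keys p.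
      aug_scale (Poly_Mapping.lookup p m) (aug_class (Poly_Mapping.single m 1)))"
    by (metis (no_types, lifting) aug_class_sum qpoly_expand sum.cong)
  also have "\<dots> \<in> aug.span (fy_class ` FY_deg k)"
  proof (intro aug.span_sum aug.span_scale)
    fix m assume "m \<in> Poly_Mapping.keys p"
    then have "mon_degree m = k" using assms by (simp add: homogeneous_def)
    then show "aug_class (Poly_Mapping.single m 1) \<in> aug.span (fy_class ` FY_deg k)"
      using mon[of m] sub[of k] by blast
  qed
  finally show ?thesis .
qed

subsection \<open>Counting the monomials\<close>

text \<open>These are the possible tails of an \<open>FY\<close> monomial after an entry with set
  \<open>E\<close>; the conditions on a tail involve the earlier entries only through
  \<open>E\<close>. \<open>FY\<close> is not the case of empty \<open>E\<close>, since its first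
  exponent may reach |F_1| rather than |F_1| - 1.\<close>

fun fy_above :: "'n::finite set \<Rightarrow> ('n set \<times> nat) list \<Rightarrow> bool" where
  "fy_above E [] \<longleftrightarrow> True"
| "fy_above E ((F, a) # fs) \<longleftrightarrow>
    E \<subset> F \<and> a \<in> {1..card F - card E - 1} \<and> fy_above F fs"

text \<open>Prefixing \<open>E\<close> shifts indices by one, so that index \<open>i\<close> in the
  longer list is the predecessor of the \<open>i\<close>-th set of \<open>fs\<close>.\<close>

lemma fy_above_iff:
  "fy_above E fs \<longleftrightarrow> sorted_wrt (\<subset>) (E # map fst fs) \<and>
    (\<forall>i<length fs. 1 \<le> snd (fs ! i) \<and>
      snd (fs ! i) \<le> card (fst (fs ! i)) - card ((E # map fst fs) ! i) - 1)"
proof (induction fs arbitrary: E)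
  case (Cons p fs)
  obtain F a where p: "p = (F, a)" by fastforce
  have "sorted_wrt (\<subset>) (E # map fst (p # fs)) \<longleftrightarrow> E \<subset> F \<and> sorted_wrt (\<subset>) (F # map fst fs)"
    by (auto simp: p)
  then show ?case unfolding p fy_above.simps Cons.IH
    by (auto simp: All_less_Suc2)
qed simp

lemma FY_Cons_iff: "(F, a) # fs \<in> FY \<longleftrightarrow> F \<noteq> {} \<and> a \<in> {1..card F} \<and> fy_above F fs"
proof -
  have "(\<forall>i<length fs. fst (fs ! i) \<noteq> {})" if "sorted_wrt (\<subset>) (F # map fst fs)"
    using that nth_mem by fastforce
  moreover have "(F # map fst fs) ! i = fst (((F, a) # fs) ! i)" if "i < length fs" for i
    using that by (cases i) auto
  ultimately show ?thesis unfolding FY_def fy_above_iff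
    by (auto simp: All_less_Suc2)
qed

lemma FY_Nil: "[] \<in> FY"
  by (simp add: FY_def)

lemma list_set_eq:
  assumes "\<And>F a fs. (F, a) # fs \<in> S \<longleftrightarrow> F \<in> A \<and> a \<in> B F \<and> fs \<in> C F" "[] \<in> S"
  shows "S = insert [] ((\<lambda>((F, a), fs). (F, a) # fs) ` (SIGMA p:Sigma A B. C (fst p)))"
proof (intro equalityI subsetI)
  fix xs assume "xs \<in> S"
  then show "xs \<in> insert [] ((\<lambda>((F, a), fs). (F, a) # fs) ` (SIGMA p:Sigma A B. C (fst p)))"
    using assms(1) by (cases xs) force+
qed (use assms in auto)

text \<open>Common recursion for counting \<open>fy_above E\<close> and \<open>FY\<close>: the empty
  list accounts for the \<open>Suc\<close>, and for a given head set the exponent and the tail are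
  chosen independently.\<close>

lemma card_list_set:
  assumes "\<And>F a fs. (F, a) # fs \<in> S \<longleftrightarrow> F \<in> A \<and> a \<in> B F \<and> fs \<in> C F" "[] \<in> S"
    and "finite A" "\<And>F. F \<in> A \<Longrightarrow> finite (B F)" "\<And>F. F \<in> A \<Longrightarrow> finite (C F)"
  shows "finite S \<and> card S = Suc (\<Sum>F\<in>A. card (B F) * card (C F))"
proof -
  let ?f = "\<lambda>((F, a), fs). (F, a) # fs" and ?T = "SIGMA p:Sigma A B. C (fst p)"
  have S: "S = insert [] (?f ` ?T)" using assms(1,2) by (rule list_set_eq)
  have fin: "finite ?T" using assms(3-5) by (intro finite_SigmaI) auto
  have "inj_on ?f ?T" by (auto simp: inj_on_def)
  then have "card (?f ` ?T) = (\<Sum>p\<in>Sigma A B. card (C (fst p)))"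
    using assms(3-5) by (subst card_image) (auto simp: card_SigmaI finite_SigmaI)
  also have "\<dots> = (\<Sum>F\<in>A. \<Sum>a\<in>B F. card (C F))"
    using assms(3-4) by (subst sum.Sigma) (auto intro!: sum.cong)
  finally have "card (?f ` ?T) = (\<Sum>F\<in>A. card (B F) * card (C F))" by simp
  moreover have "[] \<notin> ?f ` ?T" by auto
  ultimately show ?thesis unfolding S using fin by simp
qed

lemma sum_Pow_card:
  assumes "finite A"
  shows "(\<Sum>S\<in>Pow A. f (card S)) = (\<Sum>j\<le>card A. (card A choose j) * f j :: nat)"
proof -
  have "(\<Sum>S\<in>Pow A. f (card S)) = (\<Sum>j\<le>card A. \<Sum>S | S \<in> Pow A \<and> card S = j. f (card S))"
    using assms by (intro sum.group[symmetric]) (auto intro: card_mono)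
  also have "\<dots> = (\<Sum>j\<le>card A. (card A choose j) * f j)"
    using assms by (intro sum.cong refl) (simp add: n_subsets)
  finally show ?thesis .
qed

lemma sum_supersets_card:
  fixes E :: "'n::finite set"
  defines "m \<equiv> CARD('n) - card E"
  shows "(\<Sum>F | E \<subset> F. f (card F - card E)) = (\<Sum>j=1..m. (m choose j) * f j :: nat)"
proof -
  have m: "card (- E) = m" unfolding m_def by (simp add: Compl_eq_Diff_UNIV card_Diff_subset)
  have "(\<Sum>F | E \<subseteq> F. f (card F - card E)) = (\<Sum>S\<in>Pow (- E). f (card S))"
    by (rule sum.reindex_bij_witness[of _ "\<lambda>S. E \<union> S" "\<lambda>F. F - E"])
      (auto simp: card_Diff_subset)
  also have "\<dots> = f 0 + (\<Sum>j=1..m. (m choose j) * f j)"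
    by (simp add: sum_Pow_card m atMost_atLeast0 sum.atLeast_Suc_atMost)
  moreover have "{F. E \<subseteq> F} = insert E {F. E \<subset> F}" by auto
  ultimately show ?thesis by simp
qed

text \<open>This is \<open>m! / j!\<close>, written without division.\<close>

definition fact_ratio :: "nat \<Rightarrow> nat \<Rightarrow> nat"
  where "fact_ratio m j = (m choose j) * fact (m - j)"

text \<open>The identity (j + 1) * m!/(j + 1)! = m!/j!, by which both counting sums below simplify
  or telescope.\<close>

lemma fact_ratio_Suc:
  assumes "j < m"
  shows "Suc j * fact_ratio m (Suc j) = fact_ratio m j"
proof -
  have "Suc j * (m choose Suc j) = (m - j) * (m choose j)"
    using binomial_absorb_comp[of m j] binomial_absorption[of j "m - 1"] assms
    by (metis Suc_times_binomial_add add_Suc_right le_add_diff_inverse less_imp_Suc_add less_imp_le_nat mult.commute diff_add_inverse)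
  moreover have "fact (m - j) = (m - j) * fact (m - Suc j)"
    using assms by (metis Suc_diff_Suc fact_Suc of_nat_id)
  ultimately show ?thesis unfolding fact_ratio_def
    by (metis mult.assoc mult.commute)
qed

text \<open>With m = n - |E|, choosing the first set of size |E| + j leads to 1 + sum over j of (m
  choose j) (j - 1) (m - j)!. Each summand is (j - 1) m!/j! = m!/(j - 1)! - m!/j!, so the sum
  telescopes to m! - 1.\<close>

lemma card_fy_above:
  fixes E :: "'n::finite set"
  shows "finite {fs. fy_above E fs} \<and> card {fs. fy_above E fs} = fact (CARD('n) - card E)"
proof (induction "CARD('n) - card E" arbitrary: E rule: less_induct)
  case less
  let ?m = "CARD('n) - card E"
  have IH: "finite {fs. fy_above F fs} \<and> card {fs. fy_above F fs} = fact (CARD('n) - card F)"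
    if "E \<subset> F" for F
  proof (rule less.hyps)
    have "card E < card F" "card F \<le> CARD('n)" using that by (auto intro: psubset_card_mono card_mono)
    then show "CARD('n) - card F < CARD('n) - card E" by linarith
  qed
  have "finite {fs. fy_above E fs} \<and> card {fs. fy_above E fs} =
      Suc (\<Sum>F | E \<subset> F. card {1..card F - card E - 1} * card {fs. fy_above F fs})"
    by (rule card_list_set) (auto simp: IH)
  moreover have "(\<Sum>F | E \<subset> F. card {1..card F - card E - 1} * card {fs. fy_above F fs}) =
      (\<Sum>F | E \<subset> F. (card F - card E - 1) * fact (?m - (card F - card E)))"
  proof (rule sum.cong[OF refl])
    fix F assume F: "F \<in> {F. E \<subset> F}"
    then have "card E < card F" by (auto intro: psubset_card_mono)
    then show "card {1..card F - card E - 1} * card {fs. fy_above F fs} =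
        (card F - card E - 1) * fact (?m - (card F - card E))"
      using IH F by simp
  qed
  also have "\<dots> = (\<Sum>j=1..?m. (?m choose j) * ((j - 1) * fact (?m - j)))"
    by (rule sum_supersets_card)
  \<comment> \<open>The telescoped partial sum, with the subtracted term moved to the left to stay
    within the natural numbers.\<close>
  moreover have "Suc (\<Sum>j=1..k. (?m choose j) * ((j - 1) * fact (?m - j))) + fact_ratio ?m k
      = Suc (fact ?m)" if "k \<le> ?m" for k
    using that
  proof (induction k)
    case 0
    then show ?case by (simp add: fact_ratio_def)
  next
    case (Suc k)
    then show ?case using fact_ratio_Suc[of k ?m] by (simp add: fact_ratio_def algebra_simps)
  qed
  from this[of ?m] have "Suc (\<Sum>j=1..?m. (?m choose j) * ((j - 1) * fact (?m - j))) = fact ?m"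
    by (simp add: fact_ratio_def)
  ultimately show ?case by simp
qed

text \<open>The first exponent has |F_1| choices, so a first set of size j contributes (n choose j)
  j (n - j)! = n!/(j - 1)!. The empty monomial supplies the last term n!/n! = 1.\<close>

lemma card_FY:
  "finite (FY :: ('n::finite set \<times> nat) list set)"
  "card (FY :: ('n::finite set \<times> nat) list set) = (\<Sum>j\<le>CARD('n). fact_ratio CARD('n) j)"
proof -
  let ?n = "CARD('n)"
  have *: "finite (FY :: ('n set \<times> nat) list set) \<and> card (FY :: ('n set \<times> nat) list set) =
      Suc (\<Sum>F | F \<noteq> ({} :: 'n set). card {1..card F} * card {fs. fy_above F fs})"
    by (rule card_list_set) (auto simp: card_fy_above FY_Cons_iff FY_Nil)
  also have "(\<Sum>F | F \<noteq> ({} :: 'n set). card {1..card F} * card {fs. fy_above F fs}) =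
      (\<Sum>F | ({} :: 'n set) \<subset> F. (card F - card ({} :: 'n set)) * fact (?n - (card F - card ({} :: 'n set))))"
    by (intro sum.cong) (auto simp: card_fy_above)
  also have "\<dots> = (\<Sum>j=1..?n. (?n choose j) * (j * fact (?n - j)))"
    using sum_supersets_card[of "\<lambda>j. j * fact (?n - j)" "{} :: 'n set"] by simp
  finally have **: "finite (FY :: ('n set \<times> nat) list set)"
    "card (FY :: ('n set \<times> nat) list set) = Suc (\<Sum>j=1..?n. (?n choose j) * (j * fact (?n - j)))"
    using * by simp_all
  show "finite (FY :: ('n set \<times> nat) list set)" by (fact **)
  have "(\<Sum>j=1..k. (?n choose j) * (j * fact (?n - j))) = (\<Sum>j<k. fact_ratio ?n j)" if "k \<le> ?n" for k
    using that
  proof (induction k)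
    case (Suc k)
    then show ?case using fact_ratio_Suc[of k ?n] by (simp add: fact_ratio_def algebra_simps)
  qed simp
  then show "card (FY :: ('n set \<times> nat) list set) = (\<Sum>j\<le>?n. fact_ratio ?n j)"
    using **(2) by (simp add: fact_ratio_def flip: lessThan_Suc_atMost)
qed

text \<open>There are n!/(n - k)! such lists of length k, so the sum in \<open>card_FY\<close>
  appears with j = n - k. These lists index the evaluation points.\<close>

lemma card_distinct_lists:
  "finite {ws :: 'n::finite list. distinct ws}"
  "card {ws :: 'n::finite list. distinct ws} = (\<Sum>j\<le>CARD('n). fact_ratio CARD('n) j)"
proof -
  let ?n = "CARD('n)" and ?L = "\<lambda>k. {ws :: 'n list. length ws = k \<and> distinct ws \<and> set ws \<subseteq> UNIV}"
  have le: "length ws \<le> ?n" if "distinct ws" for ws :: "'n list"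
    using that by (metis card_mono distinct_card finite subset_UNIV)
  then have L: "{ws :: 'n list. distinct ws} = (\<Union>k\<le>?n. ?L k)" by auto
  have fin: "finite (?L k)" for k
    by (rule finite_subset[OF _ finite_lists_length_eq[of UNIV k]]) auto
  then show "finite {ws :: 'n list. distinct ws}" unfolding L by blast
  have "card {ws :: 'n list. distinct ws} = (\<Sum>k\<le>?n. card (?L k))"
    unfolding L using fin by (intro card_UN_disjoint) auto
  also have "\<dots> = (\<Sum>k\<le>?n. fact_ratio ?n (?n - k))"
  proof (rule sum.cong[OF refl])
    fix k assume k: "k \<in> {..?n}"
    have "card (?L k) = \<Prod>{?n - k + 1..?n}"
      using k by (intro card_lists_distinct_length_eq) auto
    also have "\<dots> = fact ?n div fact (?n - k)"
      by (simp add: fact_div_fact)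
    also have "fact ?n = fact_ratio ?n (?n - k) * fact (?n - k)"
      using k binomial_fact_lemma[of "?n - k" ?n] by (simp add: fact_ratio_def mult_ac)
    finally show "card (?L k) = fact_ratio ?n (?n - k)" by simp
  qed
  also have "\<dots> = (\<Sum>j\<le>?n. fact_ratio ?n j)"
    by (rule sum.reindex_bij_witness[of _ "\<lambda>j. ?n - j" "\<lambda>k. ?n - k"]) auto
  finally show "card {ws :: 'n list. distinct ws} = (\<Sum>j\<le>?n. fact_ratio ?n j)" .
qed

subsection \<open>Evaluation at points of the stellahedral fan\<close>

definition mon_eval :: "('v::finite \<Rightarrow> rat) \<Rightarrow> ('v \<Rightarrow>\<^sub>0 nat) \<Rightarrow> rat"
  where "mon_eval w m = (\<Prod>v\<in>UNIV. w v ^ Poly_Mapping.lookup m v)"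

definition poly_eval :: "('v::finite \<Rightarrow> rat) \<Rightarrow> 'v qpoly \<Rightarrow> rat"
  where "poly_eval w p = (\<Sum>m\<in>Poly_Mapping.keys p. Poly_Mapping.lookup p m * mon_eval w m)"

lemma mon_eval_add: "mon_eval w (m + m') = mon_eval w m * mon_eval w m'"
  by (simp add: mon_eval_def lookup_add power_add prod.distrib)

lemma poly_eval_add: "poly_eval w (p + q) = poly_eval w p + poly_eval w q"
  unfolding poly_eval_def
  by (rule sum_keys_add[where h = "\<lambda>m c. c * mon_eval w m"]) (simp_all add: algebra_simps)

lemma poly_eval_single: "poly_eval w (Poly_Mapping.single m c) = c * mon_eval w m"
  by (cases "c = 0") (simp_all add: poly_eval_def)

lemma poly_eval_0: "poly_eval w 0 = 0"
  by (simp add: poly_eval_def)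

lemma poly_eval_1: "poly_eval w 1 = 1"
  by (simp add: poly_eval_single mon_eval_def flip: single_one)

lemma poly_eval_sum: "poly_eval w (\<Sum>x\<in>A. f x) = (\<Sum>x\<in>A. poly_eval w (f x))"
  by (induction A rule: infinite_finite_induct) (simp_all add: poly_eval_add poly_eval_0)

lemma poly_eval_diff: "poly_eval w (p - q) = poly_eval w p - poly_eval w q"
  using poly_eval_add[of w "p - q" q] by simp

lemma poly_eval_mult: "poly_eval w (p * q) = poly_eval w p * poly_eval w q"
proof -
  have "p * q = (\<Sum>m\<in>Poly_Mapping.keys p. \<Sum>m'\<in>Poly_Mapping.keys q.
      Poly_Mapping.single (m + m') (Poly_Mapping.lookup p m * Poly_Mapping.lookup q m'))"
    by (subst (1) qpoly_expand[of p], subst (1) qpoly_expand[of q])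
      (simp add: sum_product mult_single)
  then show ?thesis
    by (simp add: poly_eval_sum poly_eval_single mon_eval_add poly_eval_def[of w p]
        poly_eval_def[of w q] sum_product mult_ac)
qed

lemma poly_eval_prod: "poly_eval w (\<Prod>x\<in>A. f x) = (\<Prod>x\<in>A. poly_eval w (f x))"
  by (induction A rule: infinite_finite_induct) (simp_all add: poly_eval_mult poly_eval_1)

lemma poly_eval_pvar: "poly_eval w (pvar v) = w v"
proof -
  have "mon_eval w (Poly_Mapping.single v 1) = (\<Prod>u\<in>UNIV. if u = v then w u else 1)"
    unfolding mon_eval_def by (rule prod.cong) (auto simp: lookup_single when_def)
  then show ?thesis by (simp add: pvar_def poly_eval_single)
qed

lemma poly_eval_pconst: "poly_eval w (pconst c) = c"
  by (simp add: pconst_def poly_eval_single mon_eval_def)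

section \<open>Homogeneous polynomials and homogeneous components\<close>

definition hcomp :: "nat \<Rightarrow> 'v qpoly \<Rightarrow> 'v qpoly"
  where "hcomp k p = Poly_Mapping.mapp (\<lambda>m c. c when mon_degree m = k) p"

lemma lookup_hcomp: "Poly_Mapping.lookup (hcomp k p) m = (Poly_Mapping.lookup p m when mon_degree m = k)"
  by (simp add: hcomp_def lookup_mapp when_def in_keys_iff)

lemma hcomp_0: "hcomp k 0 = 0"
  by (rule poly_mapping_eqI) (simp add: lookup_hcomp)

lemma hcomp_add: "hcomp k (p + q) = hcomp k p + hcomp k q"
  by (rule poly_mapping_eqI) (simp add: lookup_hcomp lookup_add when_add_distrib)

lemma hcomp_sum: "hcomp k (\<Sum>x\<in>A. f x) = (\<Sum>x\<in>A. hcomp k (f x))"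
  by (induction A rule: infinite_finite_induct) (simp_all add: hcomp_0 hcomp_add)

lemma homogeneous_hcomp: "homogeneous k (hcomp k p)"
  unfolding homogeneous_def Ball_def in_keys_iff lookup_hcomp by (simp add: when_def)

lemma hcomp_homogeneous:
  assumes "homogeneous j p"
  shows "hcomp k p = (if k = j then p else 0)"
  using assms by (intro poly_mapping_eqI) (auto simp: lookup_hcomp homogeneous_def in_keys_iff when_def)

lemma homogeneous_single: "homogeneous (mon_degree m) (Poly_Mapping.single m c)"
  by (simp add: homogeneous_def)

lemma homogeneous_0: "homogeneous k 0"
  by (simp add: homogeneous_def)

lemma homogeneous_1: "homogeneous 0 (1 :: 'v::finite qpoly)"
  by (simp add: homogeneous_def mon_degree_def)

lemma homogeneous_add: "homogeneous k p \<Longrightarrow> homogeneous k q \<Longrightarrow> homogeneous k (p + q)"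
  unfolding homogeneous_def using Poly_Mapping.keys_add[of p q] by blast

lemma homogeneous_uminus: "homogeneous k p \<Longrightarrow> homogeneous k (- p)"
  by (simp add: homogeneous_def)

lemma homogeneous_diff: "homogeneous k p \<Longrightarrow> homogeneous k q \<Longrightarrow> homogeneous k (p - q)"
  unfolding homogeneous_def using keys_diff[of p q] by blast

lemma homogeneous_sum: "(\<And>x. x \<in> A \<Longrightarrow> homogeneous k (f x)) \<Longrightarrow> homogeneous k (\<Sum>x\<in>A. f x)"
  by (induction A rule: infinite_finite_induct) (simp_all add: homogeneous_0 homogeneous_add)

lemma homogeneous_mult:
  fixes p q :: "'v::finite qpoly"
  assumes "homogeneous j p" "homogeneous k q"
  shows "homogeneous (j + k) (p * q)"
  unfolding homogeneous_def
proof
  fix m assume "m \<in> Poly_Mapping.keys (p * q)"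
  then obtain a b where "m = a + b" "a \<in> Poly_Mapping.keys p" "b \<in> Poly_Mapping.keys q"
    using keys_mult[of p q] by blast
  then show "mon_degree m = j + k" using assms by (simp add: homogeneous_def mon_degree_add)
qed

lemma homogeneous_power:
  fixes p :: "'v::finite qpoly"
  shows "homogeneous j p \<Longrightarrow> homogeneous (a * j) (p ^ a)"
  by (induction a) (simp_all add: homogeneous_1 homogeneous_mult)

lemma homogeneous_pvar: "homogeneous 1 (pvar v)"
  by (simp add: homogeneous_def pvar_def mon_degree_def)

lemma homogeneous_pconst: "homogeneous 0 (pconst c)"
  by (simp add: homogeneous_def pconst_def mon_degree_def)

lemma hcomp_mult:
  fixes p g :: "'v::finite qpoly"
  assumes "homogeneous d g"
  shows "hcomp k (p * g) = (if d \<le> k then hcomp (k - d) p * g else 0)"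
proof -
  have "hcomp k (Poly_Mapping.single m c * g) =
      (if d \<le> k then hcomp (k - d) (Poly_Mapping.single m c) * g else 0)" for m c
    using hcomp_homogeneous[OF homogeneous_mult[OF homogeneous_single[of m c] assms], of k]
      hcomp_homogeneous[OF homogeneous_single[of m c], of "k - d"] by auto
  then have "hcomp k ((\<Sum>m\<in>Poly_Mapping.keys p. Poly_Mapping.single m (Poly_Mapping.lookup p m)) * g) =
      (if d \<le> k then hcomp (k - d)
        (\<Sum>m\<in>Poly_Mapping.keys p. Poly_Mapping.single m (Poly_Mapping.lookup p m)) * g else 0)"
    by (simp add: sum_distrib_right hcomp_sum)
  then show ?thesis by (simp flip: qpoly_expand)
qed

section \<open>The points attached to the maximal cones\<close>

text \<open>
  The list \<open>ws\<close> encodes the maximal cone spanned by \<open>Y i\<close> for \<open>i\<close> not in \<open>ws\<close> and by \<open>X F\<close> for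
  the complements \<open>F\<close> of the nonempty prefixes of \<open>ws\<close>.  The coordinates solve the deformed
  linear relations on that cone, the sums there being telescoping.
\<close>

definition stell_point :: "('n::finite \<Rightarrow> rat) \<Rightarrow> 'n list \<Rightarrow> 'n chow_var \<Rightarrow> rat"
  where "stell_point t ws v = (case v of
    Y i \<Rightarrow> if i \<in> set ws then 0 else t i
  | X F \<Rightarrow> (\<Sum>j<length ws. if elems F = - set (take (Suc j) ws)
      then (map t ws @ [0]) ! Suc j - (map t ws @ [0]) ! j else 0))"

lemma set_take_eq_imp_eq:
  assumes "distinct ws" "j \<le> length ws" "distinct ws'" "k \<le> length ws'" "set (take j ws) = set (take k ws')"
  shows "j = k"
proof -
  have "card (set (take j ws)) = j" "card (set (take k ws')) = k"
    using assms(1-4) by (simp_all add: distinct_card)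
  with assms(5) show ?thesis by simp
qed

text \<open>Each entry is the difference of two consecutive prefix sets.\<close>

lemma distinct_lists_eq:
  assumes "distinct ws" "distinct ws'" "set ws = set ws'"
    and "\<And>j. j < length ws \<Longrightarrow> set (take (Suc j) ws) = set (take (Suc j) ws')"
  shows "ws = ws'"
proof (rule nth_equalityI)
  show len: "length ws = length ws'" using assms by (metis distinct_card)
  fix j assume j: "j < length ws"
  have *: "set (take (Suc j) us) - set (take j us) = {us ! j}" if "distinct us" "j < length us" for us :: "'a list"
    using that by (auto simp: take_Suc_conv_app_nth in_set_conv_nth distinct_conv_nth)
  have "set (take j ws) = set (take j ws')"
    using assms(4)[of "j - 1"] j by (cases j) auto
  then have "{ws ! j} = {ws' ! j}"
    using *[of ws] *[of ws'] assms j len by metis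
  then show "ws ! j = ws' ! j" by simp
qed

context
  fixes t :: "'n::finite \<Rightarrow> rat"
  assumes inj: "inj t" and nz: "\<And>i. t i \<noteq> 0"
begin

text \<open>Prefixes of different lengths have different sets, so at most one summand survives. It
  is a difference of two distinct values of \<open>t\<close>, or minus a value of \<open>t\<close>
  for the full list; injectivity and nonvanishing of \<open>t\<close> make it nonzero.\<close>

lemma stell_point_X_nonzero_iff:
  assumes ws: "distinct ws"
  shows "stell_point t ws (X F) \<noteq> 0 \<longleftrightarrow> (\<exists>j<length ws. elems F = - set (take (Suc j) ws))"
proof (cases "\<exists>j<length ws. elems F = - set (take (Suc j) ws)")
  case True
  then obtain j where j: "j < length ws" "elems F = - set (take (Suc j) ws)" by blast
  have "elems F = - set (take (Suc k) ws) \<longleftrightarrow> k = j" if "k < length ws" for k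
    using set_take_eq_imp_eq[OF ws _ ws, of "Suc k" "Suc j"] that j by auto
  then have "stell_point t ws (X F) = (\<Sum>k<length ws. if k = j
      then (map t ws @ [0]) ! Suc j - (map t ws @ [0]) ! j else 0)"
    unfolding stell_point_def chow_var.case by (intro sum.cong) auto
  then have "stell_point t ws (X F) = (map t ws @ [0]) ! Suc j - (map t ws @ [0]) ! j"
    using j by simp
  also have "\<dots> \<noteq> 0"
    using j nz inj ws by (auto simp: nth_append inj_eq distinct_conv_nth)
  finally show ?thesis using True by simp
next
  case False
  then show ?thesis by (auto simp: stell_point_def)
qed

lemma stell_point_Y_nonzero_iff: "stell_point t ws (Y i) \<noteq> 0 \<longleftrightarrow> i \<notin> set ws"
  using nz by (simp add: stell_point_def)

text \<open>If i is the entry of \<open>ws\<close> at position k, the X-coordinates with i outside F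
  come from the prefixes with j at least k; they telescope from \<open>t i\<close> to the final 0,
  giving - \<open>t i\<close>, while the Y-coordinate is 0. If i is not in \<open>ws\<close>, no
  such X-coordinate survives and the Y-coordinate is \<open>t i\<close>.\<close>

lemma stell_point_linear:
  assumes ws: "distinct ws"
  shows "stell_point t ws (Y i) - (\<Sum>F | i \<notin> elems F. stell_point t ws (X F)) = t i"
proof -
  let ?d = "\<lambda>j. (map t ws @ [0]) ! Suc j - (map t ws @ [0]) ! j"
  have "(\<Sum>F | i \<notin> elems F. stell_point t ws (X F)) =
      (\<Sum>j<length ws. \<Sum>F | i \<notin> elems F. if elems F = - set (take (Suc j) ws) then ?d j else 0)"
    unfolding stell_point_def chow_var.case by (rule sum.swap)
  also have "\<dots> = (\<Sum>j<length ws. if i \<in> set (take (Suc j) ws) then ?d j else 0)"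
  proof (rule sum.cong[OF refl])
    fix j assume "j \<in> {..<length ws}"
    then have "- set (take (Suc j) ws) \<noteq> UNIV" by (cases ws) auto
    then have eq: "elems F = - set (take (Suc j) ws) \<longleftrightarrow> F = Proper (- set (take (Suc j) ws))" for F
      by (metis (mono_tags) Proper_inverse elems_inverse mem_Collect_eq)
    have eq': "elems (Proper (- set (take (Suc j) ws))) = - set (take (Suc j) ws)"
      using \<open>_ \<noteq> UNIV\<close> by (simp add: Proper_inverse)
    show "(\<Sum>F | i \<notin> elems F. if elems F = - set (take (Suc j) ws) then ?d j else 0) =
        (if i \<in> set (take (Suc j) ws) then ?d j else 0)"
      unfolding eq by (simp add: eq')
  qed
  also have "\<dots> = (if i \<in> set ws then - t i else 0)"
  proof (cases "i \<in> set ws")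
    case True
    then obtain k where k: "k < length ws" "i = ws ! k" by (metis in_set_conv_nth)
    have "i \<in> set (take (Suc j) ws) \<longleftrightarrow> k \<le> j" if "j < length ws" for j
    proof -
      have "i \<in> set (take (Suc j) ws) \<longleftrightarrow> (\<exists>l\<le>j. ws ! l = i)"
        using that by (simp add: in_set_conv_nth min_absorb2 less_Suc_eq_le cong: conj_cong)
      also have "\<dots> \<longleftrightarrow> (\<exists>l\<le>j. l = k)"
        using that k nth_eq_iff_index_eq[OF ws] by (intro ex_cong1) auto
      finally show ?thesis by simp
    qed
    then have "(\<Sum>j<length ws. if i \<in> set (take (Suc j) ws) then ?d j else 0) =
        (\<Sum>j<length ws. if k \<le> j then ?d j else 0)"
      by (intro sum.cong) auto
    also have "\<dots> = (\<Sum>j=k..<length ws. ?d j)"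
      by (rule sum.mono_neutral_cong_right) auto
    also have "\<dots> = (map t ws @ [0]) ! length ws - (map t ws @ [0]) ! k"
      using k by (intro sum_Suc_diff') simp
    also have "\<dots> = - t i" using k by (simp add: nth_append)
    finally show ?thesis using True by simp
  next
    case False
    then show ?thesis by (auto dest: in_set_takeD intro!: sum.neutral)
  qed
  finally show ?thesis by (simp add: stell_point_def)
qed

text \<open>No support of a point contains another one. The X-coordinates make every prefix set of
  \<open>ws\<close> a prefix set of \<open>ws'\<close>, of equal length by cardinality; the
  Y-coordinates exclude further entries of \<open>ws'\<close>.\<close>

lemma stell_point_eqI:
  assumes "distinct ws" "distinct ws'"
    and sub: "\<And>v. stell_point t ws v \<noteq> 0 \<Longrightarrow> stell_point t ws' v \<noteq> 0"
  shows "ws = ws'"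
proof -
  have X: "\<exists>k<length ws'. set (take (Suc j) ws) = set (take (Suc k) ws')" if j: "j < length ws" for j
  proof -
    have "- set (take (Suc j) ws) \<noteq> UNIV" using j by (cases ws) auto
    then have F: "elems (Proper (- set (take (Suc j) ws))) = - set (take (Suc j) ws)"
      by (simp add: Proper_inverse)
    then have "stell_point t ws (X (Proper (- set (take (Suc j) ws)))) \<noteq> 0"
      using stell_point_X_nonzero_iff[OF assms(1)] j by blast
    then have "stell_point t ws' (X (Proper (- set (take (Suc j) ws)))) \<noteq> 0" by (rule sub)
    then obtain k where "k < length ws'"
      "elems (Proper (- set (take (Suc j) ws))) = - set (take (Suc k) ws')"
      using stell_point_X_nonzero_iff[OF assms(2)] by blast
    then show ?thesis unfolding F by blast
  qed
  have take: "set (take (Suc j) ws) = set (take (Suc j) ws')" if j: "j < length ws" for j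
  proof -
    obtain k where k: "k < length ws'" "set (take (Suc j) ws) = set (take (Suc k) ws')"
      using X[OF j] by blast
    then have "Suc j = Suc k"
      using assms(1,2) j by (intro set_take_eq_imp_eq) auto
    with k show ?thesis by simp
  qed
  have "set ws \<subseteq> set ws'"
  proof (cases "ws = []")
    case False
    then show ?thesis using take[of "length ws - 1"] set_take_subset[of _ ws'] by simp
  qed simp
  moreover have "set ws' \<subseteq> set ws"
    using sub[of "Y _"] stell_point_Y_nonzero_iff by blast
  ultimately show ?thesis using distinct_lists_eq assms(1,2) take by blast
qed

text \<open>At the points the quadratic generators vanish and the i-th linear generator has the
  constant value \<open>t i\<close>. Hence c * g in degree k can be traded for \<open>t i\<close>
  times the component of c in degree k - 1. The clause for k = 0 is separate because k - 1 truncates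
  there.\<close>

lemma poly_eval_hcomp_ideal:
  assumes "r \<in> aug_ideal"
  shows "\<exists>q. (k = 0 \<longrightarrow> q = 0) \<and> homogeneous (k - 1) q \<and>
    (\<forall>ws. distinct ws \<longrightarrow> poly_eval (stell_point t ws) (hcomp k r) = poly_eval (stell_point t ws) q)"
  (is "?P r")
  using assms unfolding aug_ideal_def ideal_gen_def
proof (induction rule: module.span_induct_alt[OF module_mult, consumes 1])
  case 1
  show ?case by (intro exI[of _ 0]) (simp add: homogeneous_0 hcomp_0)
next
  case (2 c g r)
  note step = 2
  have hom: "homogeneous 2 (pvar u * pvar v)" for u v :: "'n chow_var"
    using homogeneous_mult[OF homogeneous_pvar homogeneous_pvar, of u v] by (simp add: numeral_2_eq_2)
  have zero: "?P (c * g)" if "homogeneous 2 g"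
    "\<And>ws. distinct ws \<Longrightarrow> poly_eval (stell_point t ws) g = 0"
    using that by (intro exI[of _ 0]) (auto simp: homogeneous_0 hcomp_mult poly_eval_mult poly_eval_0)
  consider "g \<in> aug_gens1" | "g \<in> aug_gens2" | "g \<in> aug_gens3" using step by blast
  then have "?P (c * g)"
  proof cases
    case 1
    then obtain F G where g: "g = pvar (X F) * pvar (X G)"
      and FG: "\<not> elems F \<subseteq> elems G" "\<not> elems G \<subseteq> elems F" by (auto simp: aug_gens1_def)
    show ?thesis
    proof (rule zero)
      fix ws :: "'n list" assume ws: "distinct ws"
      have "stell_point t ws (X F) = 0 \<or> stell_point t ws (X G) = 0"
      proof (rule ccontr)
        assume "\<not> ?thesis"
        then obtain j k where "elems F = - set (take (Suc j) ws)" "elems G = - set (take (Suc k) ws)"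
          using stell_point_X_nonzero_iff[OF ws] by blast
        then show False using FG set_take_subset_set_take[of "Suc j" "Suc k" ws]
            set_take_subset_set_take[of "Suc k" "Suc j" ws] by (metis Compl_anti_mono nat_le_linear)
      qed
      then show "poly_eval (stell_point t ws) g = 0"
        by (auto simp: g poly_eval_mult poly_eval_pvar)
    qed (simp add: g hom)
  next
    case 2
    then obtain i F where g: "g = pvar (Y i) * pvar (X F)" and i: "i \<notin> elems F"
      by (auto simp: aug_gens2_def)
    show ?thesis
    proof (rule zero)
      fix ws :: "'n list" assume ws: "distinct ws"
      have "stell_point t ws (Y i) = 0 \<or> stell_point t ws (X F) = 0"
        using i stell_point_X_nonzero_iff[OF ws, of F] stell_point_Y_nonzero_iff[of ws i]
        by (auto dest: in_set_takeD)
      then show "poly_eval (stell_point t ws) g = 0"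
        by (auto simp: g poly_eval_mult poly_eval_pvar)
    qed (simp add: g hom)
  next
    case 3
    then obtain i where g: "g = pvar (Y i) - (\<Sum>F | i \<notin> elems F. pvar (X F))"
      by (auto simp: aug_gens3_def)
    have hg: "homogeneous 1 g"
      unfolding g by (intro homogeneous_diff homogeneous_sum homogeneous_pvar)
    have eg: "poly_eval (stell_point t ws) g = t i" if "distinct ws" for ws
      using stell_point_linear[OF that, of i]
      by (simp add: g poly_eval_diff poly_eval_sum poly_eval_pvar)
    show ?thesis
    proof (cases "k = 0")
      case True
      then show ?thesis
        by (intro exI[of _ 0]) (simp add: hcomp_mult[OF hg] homogeneous_0)
    next
      case False
      then have "hcomp k (c * g) = hcomp (k - 1) c * g"
        by (simp add: hcomp_mult[OF hg])
      moreover have "homogeneous (k - 1) (pconst (t i) * hcomp (k - 1) c)"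
        using homogeneous_mult[OF homogeneous_pconst homogeneous_hcomp] by fastforce
      ultimately show ?thesis using False
        by (intro exI[of _ "pconst (t i) * hcomp (k - 1) c"])
          (simp add: eg poly_eval_mult poly_eval_pconst)
    qed
  qed
  then obtain q where q: "k = 0 \<longrightarrow> q = 0" "homogeneous (k - 1) q"
    "\<And>ws. distinct ws \<Longrightarrow> poly_eval (stell_point t ws) (hcomp k (c * g)) = poly_eval (stell_point t ws) q"
    by blast
  obtain q' where q': "k = 0 \<longrightarrow> q' = 0" "homogeneous (k - 1) q'"
    "\<And>ws. distinct ws \<Longrightarrow> poly_eval (stell_point t ws) (hcomp k r) = poly_eval (stell_point t ws) q'"
    using step by blast
  show ?case
    using q q' by (intro exI[of _ "q + q'"]) (simp add: homogeneous_add hcomp_add poly_eval_add)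
qed

end

subsection \<open>Linear independence\<close>

interpretation fun_space: vector_space "\<lambda>(c :: rat) (f :: 'a \<Rightarrow> rat) x. c * f x"
  by unfold_locales (auto simp: fun_eq_iff algebra_simps)

lemma sum_fun_apply: "(\<Sum>x\<in>A. f x) y = (\<Sum>x\<in>A. f x y :: 'a::comm_monoid_add)"
  by (induction A rule: infinite_finite_induct) simp_all

text \<open>Evaluating a relation among the functions \<open>f d\<close> at a point of
  \<open>D\<close> isolates one coefficient, so they are independent and the exchange lemma
  applies.\<close>

lemma card_diagonal_le_card_spanning:
  fixes f :: "'a \<Rightarrow> 'a \<Rightarrow> rat"
  assumes fin: "finite T" "finite D" and span: "\<And>d. d \<in> D \<Longrightarrow> f d \<in> fun_space.span T"
    and diag: "\<And>d. d \<in> D \<Longrightarrow> f d d \<noteq> 0"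
    and off: "\<And>d e. d \<in> D \<Longrightarrow> e \<in> D \<Longrightarrow> d \<noteq> e \<Longrightarrow> f d e = 0"
  shows "card D \<le> card T"
proof -
  have inj: "inj_on f D"
    using diag off by (metis inj_onI)
  have "fun_space.independent (f ` D)"
  proof (rule fun_space.independent_if_scalars_zero)
    fix c g assume sum: "(\<Sum>g\<in>f ` D. (\<lambda>x. c g * g x)) = 0" and "g \<in> f ` D"
    then obtain d where d: "d \<in> D" "g = f d" by blast
    have "0 = (\<Sum>g\<in>f ` D. (\<lambda>x. c g * g x)) d" using sum by simp
    also have "\<dots> = (\<Sum>g\<in>f ` D. c g * g d)"
      by (rule sum_fun_apply)
    also have "\<dots> = (\<Sum>e\<in>D. c (f e) * f e d)"
      using inj by (simp add: sum.reindex)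
    also have "\<dots> = (\<Sum>e\<in>D. if e = d then c (f d) * f d d else 0)"
      using off d by (intro sum.cong) auto
    also have "\<dots> = c g * g d" using d fin by simp
    finally show "c g = 0" using diag d by simp
  qed (use fin in simp)
  then have "card (f ` D) \<le> card T"
    using fun_space.independent_span_bound[OF fin(1)] span by blast
  then show ?thesis using inj by (simp add: card_image)
qed

section \<open>Homogeneous polynomial lifts and independence of the classes\<close>

definition x_poly :: "'n::finite set \<Rightarrow> 'n chow_var qpoly"
  where "x_poly F = (if F = UNIV then - (\<Sum>G\<in>UNIV. pvar (X G)) else pvar (X (Proper F)))"

definition fy_poly :: "('n::finite set \<times> nat) list \<Rightarrow> 'n chow_var qpoly"
  where "fy_poly fs = prod_list (map (\<lambda>(F, a). x_poly F ^ a) fs)"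

lemma aug_class_x_poly: "aug_class (x_poly F) = x_elem F"
  by (simp add: x_poly_def x_elem_def aug_class_simps aug_class_sum)

lemma aug_class_fy_poly: "aug_class (fy_poly fs) = fy_class fs"
  by (induction fs)
    (auto simp: fy_poly_def fy_class_def aug_class_simps aug_class_power aug_class_x_poly)

lemma homogeneous_x_poly: "homogeneous 1 (x_poly F)"
  unfolding x_poly_def
  by (simp only: split: if_split) (intro conjI impI homogeneous_uminus homogeneous_sum homogeneous_pvar)

lemma homogeneous_fy_poly: "homogeneous (sum_list (map snd fs)) (fy_poly fs)"
proof (induction fs)
  case (Cons p fs)
  then show ?case
    using homogeneous_mult[OF homogeneous_power[OF homogeneous_x_poly, of "snd p" "fst p"] Cons]
    by (simp add: fy_poly_def case_prod_unfold)
qed (simp add: fy_poly_def homogeneous_1)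

lemma ex_inj_nonzero: "\<exists>t :: 'n::finite \<Rightarrow> rat. inj t \<and> (\<forall>i. t i \<noteq> 0)"
proof -
  obtain f :: "'n \<Rightarrow> nat" where f: "inj f"
    using finite_imp_inj_to_nat_seg[of "UNIV :: 'n set"] by auto
  show ?thesis
    by (rule exI[of _ "\<lambda>i. of_nat (Suc (f i))"])
      (use f in \<open>auto simp: inj_def simp del: of_nat_Suc\<close>)
qed

text \<open>If \<open>c fs0\<close> were nonzero, the relation would make \<open>fs0\<close>
  dispensable: the values of the other |FY| - 1 monomials would span the evaluations of all
  homogeneous polynomials. These include |FY| independent functions, one for each point.\<close>

lemma fy_class_relation_trivial:
  fixes c :: "('n::finite set \<times> nat) list \<Rightarrow> rat"
  assumes rel: "(\<Sum>fs\<in>FY. aug_scale (c fs) (fy_class fs)) = 0" and "fs0 \<in> FY"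
  shows "c fs0 = 0"
proof (rule ccontr)
  assume c0: "c fs0 \<noteq> 0"
  obtain t :: "'n \<Rightarrow> rat" where t: "inj t" "\<And>i. t i \<noteq> 0" using ex_inj_nonzero by blast
  let ?D = "{ws :: 'n list. distinct ws}"
  \<comment> \<open>The value 0 on lists with repetitions makes equality of these functions the same
    as agreement at all the points.\<close>
  define ev where "ev p = (\<lambda>ws. if distinct ws then poly_eval (stell_point t ws) p else 0)" for p
  let ?W = "fun_space.span (ev ` fy_poly ` (FY - {fs0}))"
  let ?deg = "\<lambda>fs :: ('n set \<times> nat) list. sum_list (map snd fs)"
  have ev_add: "ev (p + q) = ev p + ev q" for p q
    by (auto simp: ev_def poly_eval_add fun_eq_iff)
  have ev_diff: "ev (p - q) = ev p - ev q" for p q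
    by (auto simp: ev_def poly_eval_diff fun_eq_iff)
  have ev_scale: "ev (pconst a * p) = (\<lambda>ws. a * ev p ws)" for a p
    by (auto simp: ev_def poly_eval_mult poly_eval_pconst fun_eq_iff)
  have ev_0: "ev 0 = 0" by (auto simp: ev_def poly_eval_0 fun_eq_iff)
  have ev_sum: "ev (\<Sum>x\<in>A. f x) = (\<Sum>x\<in>A. ev (f x))" for A :: "('n set \<times> nat) list set" and f
    by (induction A rule: infinite_finite_induct) (simp_all only: sum.infinite sum.empty sum.insert ev_0 ev_add not_False_eq_True)
  have ideal: "\<exists>q. (k = 0 \<longrightarrow> q = 0) \<and> homogeneous (k - 1) q \<and> ev (hcomp k r) = ev q"
    if "r \<in> aug_ideal" for r k
    using poly_eval_hcomp_ideal[OF t that, of k] by (force simp: ev_def fun_eq_iff)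
  have scaled: "ev (pconst a * fy_poly fs) \<in> ?W" if "fs \<in> FY" "fs \<noteq> fs0" for a fs
    unfolding ev_scale using that by (intro fun_space.span_scale fun_space.span_base) blast
  define r where "r = (\<Sum>fs\<in>FY. pconst (c fs) * fy_poly fs)"
  have r: "r \<in> aug_ideal"
    using rel by (simp add: r_def aug_class_sum aug_class_fy_poly aug_scale_def
        aug_class_simps flip: aug_class_eq_0_iff)
  have hom: "homogeneous (?deg fs) (pconst a * fy_poly fs)" for fs a
    using homogeneous_mult[OF homogeneous_pconst[of a] homogeneous_fy_poly[of fs]] by simp
  \<comment> \<open>Modulo the ideal, \<open>p\<close> is a combination \<open>s\<close> of
    \<open>FY\<close> monomials of degree \<open>j\<close>. On the points, \<open>p - s\<close>
    agrees with a polynomial of degree \<open>j - 1\<close>, or with 0 if \<open>j = 0\<close>, so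
    the induction hypothesis applies.\<close>
  have homogeneous_ev: "ev p \<in> ?W" if "homogeneous j p" for j p
    using that
  proof (induction j arbitrary: p rule: less_induct)
    case (less j)
    have lower: "ev (hcomp j s) \<in> ?W" if s: "s \<in> aug_ideal" for s
    proof -
      obtain q where q: "j = 0 \<longrightarrow> q = 0" "homogeneous (j - 1) q" "ev (hcomp j s) = ev q"
        using ideal[OF s] by blast
      then show ?thesis
        using less.IH[of "j - 1" q] by (cases "j = 0") (auto simp: ev_0 fun_space.span_zero)
    qed
    have fy: "ev (pconst a * fy_poly fs) \<in> ?W" if fs: "fs \<in> FY_deg j" for a fs
    proof (cases "fs = fs0")
      case True
      \<comment> \<open>The given relation may mix degrees; its component in degree \<open>j\<close>
        lets the term of \<open>fs0\<close> be solved for. That component evaluates like a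
        polynomial of lower degree.\<close>
      have "hcomp j r = (\<Sum>fs\<in>FY. if ?deg fs = j then pconst (c fs) * fy_poly fs else 0)"
        unfolding r_def hcomp_sum by (intro sum.cong) (auto simp: hcomp_homogeneous[OF hom])
      also have "\<dots> = pconst (c fs0) * fy_poly fs0 +
          (\<Sum>fs\<in>FY - {fs0}. if ?deg fs = j then pconst (c fs) * fy_poly fs else 0)"
        using assms(2) fs True by (subst sum.remove[OF card_FY(1), of fs0]) (auto simp: FY_deg_def)
      finally have "pconst (c fs0) * fy_poly fs0 =
          hcomp j r - (\<Sum>fs\<in>FY - {fs0}. if ?deg fs = j then pconst (c fs) * fy_poly fs else 0)"
        by simp
      then have "ev (pconst (c fs0) * fy_poly fs0) = ev (hcomp j r) -
          (\<Sum>fs\<in>FY - {fs0}. ev (if ?deg fs = j then pconst (c fs) * fy_poly fs else 0))"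
        by (simp only: ev_diff ev_sum)
      also have "\<dots> \<in> ?W"
        using lower[OF r] scaled
        by (intro fun_space.span_diff fun_space.span_sum) (auto simp: ev_0 fun_space.span_zero)
      finally have "(\<lambda>ws. (a / c fs0) * ev (pconst (c fs0) * fy_poly fs0) ws) \<in> ?W"
        by (rule fun_space.span_scale)
      then show ?thesis using c0 True by (simp add: ev_scale)
    next
      case False
      then show ?thesis using scaled fs by (auto simp: FY_deg_def)
    qed
    have fin: "finite (FY_deg j :: ('n set \<times> nat) list set)"
      using card_FY(1) by (rule rev_finite_subset) (auto simp: FY_deg_def)
    have "\<exists>b. aug_class p = (\<Sum>fs\<in>FY_deg j. aug_scale (b fs) (fy_class fs))"
      using aug_class_homogeneous_in_span_FY[OF less.prems]
    proof (induction rule: aug.span_induct_alt)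
      case base
      then show ?case by (intro exI[of _ "\<lambda>_. 0"]) simp
    next
      case (step d x y)
      then obtain b fs where "y = (\<Sum>fs\<in>FY_deg j. aug_scale (b fs) (fy_class fs))"
        "fs \<in> FY_deg j" "x = fy_class fs" by blast
      then show ?case
        using fin
        by (intro exI[of _ "\<lambda>gs. (if gs = fs then d else 0) + b gs"])
          (simp add: aug.scale_left_distrib sum.distrib if_distrib[of "\<lambda>c. aug_scale c _"] cong: if_cong)
    qed
    then obtain b where b: "aug_class p = (\<Sum>fs\<in>FY_deg j. aug_scale (b fs) (fy_class fs))" by blast
    define s where "s = (\<Sum>fs\<in>FY_deg j. pconst (b fs) * fy_poly fs)"
    have "p - s \<in> aug_ideal"
      using b by (simp add: s_def aug_class_sum aug_class_fy_poly aug_scale_def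
        aug_class_simps flip: aug_class_eq_iff)
    moreover have "homogeneous j s"
      unfolding s_def using hom by (intro homogeneous_sum) (auto simp: FY_deg_def)
    then have "hcomp j (p - s) = p - s"
      using hcomp_homogeneous[OF homogeneous_diff[OF less.prems]] by simp
    ultimately have "ev (p - s) \<in> ?W" using lower by metis
    moreover have "ev s \<in> ?W"
      unfolding s_def ev_sum using fy by (intro fun_space.span_sum)
    ultimately have "ev (p - s) + ev s \<in> ?W" by (rule fun_space.span_add)
    then show ?case by (simp only: diff_add_cancel flip: ev_add)
  qed
  \<comment> \<open>The product of the variables in the support of one point is nonzero there and
    vanishes at every other point, where by \<open>stell_point_eqI\<close> some factor is 0.\<close>
  have "ev (\<Prod>v\<in>A. pvar v) \<in> ?W" for A :: "'n chow_var set"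
  proof -
    have "homogeneous (card A) (\<Prod>v\<in>A. pvar v)"
    proof (induction A rule: infinite_finite_induct)
      case (insert v A)
      then show ?case using homogeneous_mult[OF homogeneous_pvar insert.IH, of v] by simp
    qed (simp_all add: homogeneous_1)
    then show ?thesis by (rule homogeneous_ev)
  qed
  moreover have "\<exists>v. stell_point t ws v \<noteq> 0 \<and> stell_point t ws' v = 0"
    if "distinct ws" "distinct ws'" "ws \<noteq> ws'" for ws ws'
    using stell_point_eqI[OF t that(1,2)] that(3) by blast
  ultimately have "card ?D \<le> card (ev ` fy_poly ` (FY - {fs0}))"
    using card_distinct_lists(1) card_FY(1)
    by (intro card_diagonal_le_card_spanning[where f =
          "\<lambda>ws. ev (\<Prod>v | stell_point t ws v \<noteq> 0. pvar v)"])
      (auto simp: ev_def poly_eval_prod poly_eval_pvar)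
  also have "\<dots> \<le> card (FY - {fs0} :: ('n set \<times> nat) list set)"
    using card_FY(1) by (intro order.trans[OF card_image_le card_image_le]) auto
  also have "\<dots> < card (FY :: ('n set \<times> nat) list set)"
    using card_FY(1) assms(2) by (rule card_Diff1_less)
  also have "\<dots> = card ?D" by (simp add: card_FY(2) card_distinct_lists(2))
  finally show False by simp
qed

subsection \<open>The Chow ring of the fan\<close>

definition is_face :: "'n chow_var set \<Rightarrow> bool"
  where "is_face S \<longleftrightarrow>
    (\<forall>F G. X F \<in> S \<longrightarrow> X G \<in> S \<longrightarrow> elems F \<subseteq> elems G \<or> elems G \<subseteq> elems F) \<and>
    (\<forall>i F. Y i \<in> S \<longrightarrow> X F \<in> S \<longrightarrow> i \<in> elems F)"

lemma is_face_subset: "is_face T \<Longrightarrow> S \<subseteq> T \<Longrightarrow> is_face S"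
  unfolding is_face_def by blast

abbreviation real_ray :: "'n::finite chow_var \<Rightarrow> real ^ 'n"
  where "real_ray v \<equiv> \<chi> j. of_int (ray v j)"

lemma ray_cone_subset:
  "(\<And>v. v \<in> T \<Longrightarrow> real_ray v \<in> P) \<Longrightarrow> convex_cone P \<Longrightarrow> ray_cone T \<subseteq> P"
  unfolding ray_cone_def by (rule hull_minimal) auto

lemma finite_chain_least:
  assumes "finite C" "C \<noteq> {}" "\<And>F G. F \<in> C \<Longrightarrow> G \<in> C \<Longrightarrow> F \<subseteq> G \<or> G \<subseteq> F"
  shows "\<exists>m\<in>C. \<forall>G\<in>C. m \<subseteq> G"
  using finite_has_minimal[OF assms(1,2)] assms(3) by metis

lemma finite_chain_greatest:
  assumes "finite C" "C \<noteq> {}" "\<And>F G. F \<in> C \<Longrightarrow> G \<in> C \<Longrightarrow> F \<subseteq> G \<or> G \<subseteq> F"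
  shows "\<exists>m\<in>C. \<forall>G\<in>C. G \<subseteq> m"
  using finite_has_maximal[OF assms(1,2)] assms(3) by metis

text \<open>
  If \<open>v \<notin> T\<close>, one of the half-spaces \<open>x_i \<le> 0\<close>, \<open>0 \<le> x_i\<close>, \<open>x_j \<le> x_i\<close> contains the rays of
  \<open>T\<close> but not that of \<open>v\<close>.
\<close>

lemma mem_if_ray_in_ray_cone:
  fixes T :: "'n::finite chow_var set"
  assumes T: "is_face T" and v: "real_ray v \<in> ray_cone T"
  shows "v \<in> T"
proof (rule ccontr)
  assume "v \<notin> T"
  show False
  proof (cases v)
    case (Y i)
    have "ray_cone T \<subseteq> {x. x $ i \<le> 0}"
    proof (rule ray_cone_subset)
      fix u assume "u \<in> T"
      with \<open>v \<notin> T\<close> Y show "real_ray u \<in> {x. x $ i \<le> 0}"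
        by (cases u) (auto simp: ray_def)
    qed (auto simp: convex_cone_iff mult_nonneg_nonpos)
    with v Y show False by (auto simp: ray_def)
  next
    case (X F)
    \<comment> \<open>The sets in \<open>T\<close> are split by whether they contain F. Below, i
      lies outside F but in every member of \<open>B\<close>, and j, if \<open>A\<close> is
      nonempty, lies in F but outside every member of \<open>A\<close>.\<close>
    define A where "A = {elems G | G. X G \<in> T \<and> \<not> elems F \<subseteq> elems G}"
    define B where "B = {elems G | G. X G \<in> T \<and> elems F \<subseteq> elems G}"
    have chain: "G \<subseteq> H \<or> H \<subseteq> G" if "G \<in> A \<and> H \<in> A \<or> G \<in> B \<and> H \<in> B" for G H
      using T that unfolding A_def B_def is_face_def by blast
    obtain i where i: "i \<notin> elems F" "\<And>G. G \<in> B \<Longrightarrow> i \<in> G"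
    proof (cases "B = {}")
      case True
      then show thesis using that elems[of F] by blast
    next
      case False
      then have "\<exists>m\<in>B. \<forall>G\<in>B. m \<subseteq> G"
        using chain by (intro finite_chain_least) auto
      then obtain m where m: "m \<in> B" "\<And>G. G \<in> B \<Longrightarrow> m \<subseteq> G" by blast
      moreover have "elems F \<notin> B" using \<open>v \<notin> T\<close> X by (auto simp: B_def elems_inject)
      ultimately have "elems F \<subset> m" by (auto simp: B_def)
      then show thesis using that m by blast
    qed
    have AB: "elems G \<in> A \<or> elems G \<in> B" if "X G \<in> T" for G
      using that unfolding A_def B_def by blast
    show False
    proof (cases "A = {}")
      case True
      have "ray_cone T \<subseteq> {x. 0 \<le> x $ i}"
      proof (rule ray_cone_subset)
        fix u assume "u \<in> T"
        with True AB i show "real_ray u \<in> {x. 0 \<le> x $ i}"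
          by (cases u) (auto simp: ray_def)
      qed (auto simp: convex_cone_iff)
      with v X i show False by (auto simp: ray_def)
    next
      case False
      then have "\<exists>m\<in>A. \<forall>G\<in>A. G \<subseteq> m"
        using chain by (intro finite_chain_greatest) auto
      then obtain m where m: "m \<in> A" "\<And>G. G \<in> A \<Longrightarrow> G \<subseteq> m" by blast
      then obtain j where j: "j \<in> elems F" "j \<notin> m" by (auto simp: A_def)
      \<comment> \<open>The ray e_j would violate x_j \<le> x_i; it cannot occur because j is
        missing from the set m of the face \<open>T\<close>.\<close>
      have "Y j \<notin> T" using T m(1) j(2) by (auto simp: A_def is_face_def)
      have "ray_cone T \<subseteq> {x. x $ j \<le> x $ i}"
      proof (rule ray_cone_subset)
        fix u assume u: "u \<in> T"
        show "real_ray u \<in> {x. x $ j \<le> x $ i}"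
        proof (cases u)
          case (Y k)
          then show ?thesis using u \<open>Y j \<notin> T\<close> by (auto simp: ray_def)
        next
          case (X G)
          then show ?thesis using AB[of G] u i(2)[of "elems G"] m(2)[of "elems G"] j(2)
            by (auto simp: ray_def)
        qed
      qed (auto simp: convex_cone_iff add_mono mult_left_mono)
      with v X i j show False by (auto simp: ray_def)
    qed
  qed
qed

text \<open>Membership in the fan concerns the cone as a set of points, so another generating set
  might produce the same cone. \<open>mem_if_ray_in_ray_cone\<close> puts every generator in
  \<open>S\<close> into the face that presents the cone, and subsets of faces are faces.\<close>

lemma ray_cone_in_stell_fan_iff:
  fixes S :: "'n::finite chow_var set"
  shows "ray_cone S \<in> stell_fan \<longleftrightarrow> is_face S"
proof
  assume "ray_cone S \<in> stell_fan"
  then obtain I C where T: "ray_cone S = ray_cone (Y ` I \<union> X ` C)"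
    and "\<forall>F\<in>C. \<forall>G\<in>C. elems F \<subseteq> elems G \<or> elems G \<subseteq> elems F" "\<forall>F\<in>C. I \<subseteq> elems F"
    unfolding stell_fan_def by blast
  then have face: "is_face (Y ` I \<union> X ` C)" by (auto simp: is_face_def)
  have "real_ray v \<in> ray_cone S" if "v \<in> S" for v
    unfolding ray_cone_def using that by (intro hull_inc) auto
  then have "S \<subseteq> Y ` I \<union> X ` C"
    using mem_if_ray_in_ray_cone[OF face] T by auto
  then show "is_face S" using face is_face_subset by blast
next
  assume S: "is_face S"
  have "S = Y ` {i. Y i \<in> S} \<union> X ` {F. X F \<in> S}"
  proof (intro equalityI subsetI)
    fix v assume "v \<in> S"
    then show "v \<in> Y ` {i. Y i \<in> S} \<union> X ` {F. X F \<in> S}" by (cases v) auto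
  qed auto
  then have "ray_cone S = ray_cone (Y ` {i. Y i \<in> S} \<union> X ` {F. X F \<in> S})" by (rule arg_cong)
  moreover have "\<forall>F\<in>{F. X F \<in> S}. \<forall>G\<in>{F. X F \<in> S}. elems F \<subseteq> elems G \<or> elems G \<subseteq> elems F"
    "\<forall>F\<in>{F. X F \<in> S}. {i. Y i \<in> S} \<subseteq> elems F"
    using S by (auto simp: is_face_def)
  ultimately show "ray_cone S \<in> stell_fan"
    unfolding stell_fan_def mem_Collect_eq by (intro exI conjI)
qed

section \<open>Linear relations of the fan and equality of the two ideals\<close>

lemma pconst_0: "pconst 0 = 0"
  and pconst_add: "pconst (a + b) = pconst a + pconst b"
  and pconst_mult: "pconst (a * b) = pconst a * pconst b"
  by (simp_all add: pconst_def single_add mult_single)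

lemma pconst_sum: "pconst (\<Sum>x\<in>A. f x) = (\<Sum>x\<in>A. pconst (f x))"
  by (induction A rule: infinite_finite_induct) (simp_all add: pconst_0 pconst_add)

lemma linear_gen_eq_sum_rays:
  fixes i :: "'n::finite"
  shows "pvar (Y i) - (\<Sum>F | i \<notin> elems F. pvar (X F)) =
    (\<Sum>v\<in>UNIV. pconst (of_int (ray v i)) * pvar v)"
proof -
  have 1: "pconst 1 = (1 :: 'n chow_var qpoly)" "pconst (- 1) = (- 1 :: 'n chow_var qpoly)"
    by (simp_all add: pconst_def single_uminus)
  have UNIV: "(UNIV :: 'n chow_var set) = range Y \<union> range X"
    by (metis UNIV_eq_I UnCI rangeI chow_var.exhaust)
  have "(\<Sum>v\<in>UNIV. pconst (of_int (ray v i)) * pvar v) =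
      (\<Sum>k\<in>UNIV. pconst (of_int (ray (Y k) i)) * pvar (Y k)) +
      (\<Sum>F\<in>UNIV. pconst (of_int (ray (X F) i)) * pvar (X F))"
    unfolding UNIV by (subst sum.union_disjoint) (auto simp: sum.reindex inj_on_def)
  also have "(\<Sum>k\<in>UNIV. pconst (of_int (ray (Y k) i)) * pvar (Y k)) =
      (\<Sum>k\<in>UNIV. if k = i then pvar (Y i) else 0)"
    by (rule sum.cong) (auto simp: ray_def 1 pconst_0)
  also have "(\<Sum>F\<in>UNIV. pconst (of_int (ray (X F) i)) * pvar (X F)) =
      (\<Sum>F\<in>UNIV. if i \<notin> elems F then - pvar (X F) else 0)"
    by (rule sum.cong) (auto simp: ray_def 1 pconst_0)
  also have "\<dots> = (\<Sum>F | i \<notin> elems F. - pvar (X F))"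
    by (rule sum.inter_filter[symmetric, of UNIV, simplified]) simp
  finally show ?thesis by (simp add: sum_negf)
qed

lemma ideal_gen_subset:
  assumes "\<And>g. g \<in> S \<Longrightarrow> g \<in> ideal_gen T"
  shows "ideal_gen S \<subseteq> ideal_gen T"
  using assms unfolding ideal_gen_def
  by (intro module.span_minimal[OF module_mult] module.subspace_span[OF module_mult]) blast

lemma ideal_gen_base: "g \<in> S \<Longrightarrow> g \<in> ideal_gen S"
  unfolding ideal_gen_def by (rule module.span_base[OF module_mult])

text \<open>Being a face is a condition on pairs, so the monomial of a non-face is a multiple of a
  quadratic generator, and each quadratic generator comes from a two-element non-face. The
  coordinate functionals generate all integral linear forms and yield the generators y_i - sum of
  x_F.\<close>

theorem stell_chow_ideal_eq: "(stell_chow_ideal :: 'n::finite chow_var qpoly set) = aug_ideal"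
proof (rule antisym)
  show "(stell_chow_ideal :: 'n chow_var qpoly set) \<subseteq> aug_ideal"
    unfolding stell_chow_ideal_def aug_ideal_def
  proof (rule ideal_gen_subset, fold aug_ideal_def)
    fix g :: "'n chow_var qpoly" assume "g \<in> stell_SR_gens \<union> stell_linear_gens"
    then show "g \<in> aug_ideal"
    proof
      assume "g \<in> stell_SR_gens"
      then obtain S where S: "g = (\<Prod>v\<in>S. pvar v)" "\<not> is_face S"
        by (auto simp: stell_SR_gens_def ray_cone_in_stell_fan_iff)
      then obtain u v where uv: "u \<in> S" "v \<in> S" "u \<noteq> v" "pvar u * pvar v \<in> aug_gens1 \<union> aug_gens2"
        unfolding is_face_def aug_gens1_def aug_gens2_def by blast
      then have "g = (\<Prod>v\<in>S - {u} - {v}. pvar v) * (pvar u * pvar v)"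
        using S by (simp add: prod.remove[of S u] prod.remove[of "S - {u}" v] mult_ac)
      moreover have "pvar u * pvar v \<in> aug_ideal"
        using uv unfolding aug_ideal_def by (intro ideal_gen_base) blast
      ultimately show ?thesis by (simp only: aug_ideal_mult)
    next
      assume "g \<in> stell_linear_gens"
      then obtain m where g: "g = (\<Sum>v\<in>UNIV. pconst (of_int (\<Sum>j\<in>UNIV. m j * ray v j)) * pvar v)"
        by (auto simp: stell_linear_gens_def)
      also have "\<dots> = (\<Sum>v\<in>UNIV. \<Sum>j\<in>UNIV. pconst (of_int (m j)) * (pconst (of_int (ray v j)) * pvar v))"
        by (simp add: pconst_sum pconst_mult sum_distrib_right mult.assoc)
      also have "\<dots> = (\<Sum>j\<in>UNIV. pconst (of_int (m j)) *
          (pvar (Y j) - (\<Sum>F | j \<notin> elems F. pvar (X F))))"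
        by (subst sum.swap) (simp add: linear_gen_eq_sum_rays sum_distrib_left)
      also have "\<dots> \<in> aug_ideal"
        unfolding aug_ideal_def ideal_gen_def
        by (intro module.span_sum[OF module_mult] module.span_scale[OF module_mult]
            module.span_base[OF module_mult]) (auto simp: aug_gens3_def)
      finally show ?thesis .
    qed
  qed
  show "(aug_ideal :: 'n chow_var qpoly set) \<subseteq> stell_chow_ideal"
    unfolding stell_chow_ideal_def aug_ideal_def
  proof (intro ideal_gen_subset ideal_gen_base)
    fix g :: "'n chow_var qpoly" assume g: "g \<in> aug_gens1 \<union> aug_gens2 \<union> aug_gens3"
    have SR: "pvar u * pvar v \<in> stell_SR_gens" if "u \<noteq> v" "\<not> is_face {u, v}" for u v :: "'n chow_var"
    proof -
      have "pvar u * pvar v = (\<Prod>w\<in>{u, v}. pvar w :: 'n chow_var qpoly)" using that by simp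
      then show ?thesis unfolding stell_SR_gens_def ray_cone_in_stell_fan_iff using that by blast
    qed
    have linear: "pvar (Y i) - (\<Sum>F | i \<notin> elems F. pvar (X F)) \<in> stell_linear_gens" for i :: 'n
    proof -
      have "ray v i = (\<Sum>j\<in>UNIV. (if j = i then 1 else 0) * ray v j)" for v :: "'n chow_var"
        by (simp add: if_distrib[of "\<lambda>c. c * _"] cong: if_cong)
      then show ?thesis
        unfolding stell_linear_gens_def linear_gen_eq_sum_rays by auto
    qed
    from g consider "g \<in> aug_gens1" | "g \<in> aug_gens2" | "g \<in> aug_gens3" by blast
    then show "g \<in> stell_SR_gens \<union> stell_linear_gens"
    proof cases
      case 1
      then obtain F G where "g = pvar (X F) * pvar (X G)"
        "\<not> elems F \<subseteq> elems G" "\<not> elems G \<subseteq> elems F" by (auto simp: aug_gens1_def)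
      then show ?thesis using SR[of "X F" "X G"] unfolding is_face_def by blast
    next
      case 2
      then obtain i F where "g = pvar (Y i) * pvar (X F)" "i \<notin> elems F"
        by (auto simp: aug_gens2_def)
      then show ?thesis using SR[of "Y i" "X F"] unfolding is_face_def by blast
    next
      case 3
      then show ?thesis using linear by (auto simp: aug_gens3_def)
    qed
  qed
qed

subsection \<open>The permutation action\<close>

lemma aug_act_class: "aug_act \<sigma> (aug_class p) = aug_class (map_vars (perm_var \<sigma>) p)"
  by (simp add: aug_act.abs_eq)

lemma aug_act_add: "aug_act \<sigma> (a + b) = aug_act \<sigma> a + aug_act \<sigma> b"
  by (induction a rule: aug_chow.abs_induct, induction b rule: aug_chow.abs_induct)
    (simp add: aug_act_class map_vars_add flip: aug_class_simps)

lemma aug_act_mult: "aug_act \<sigma> (a * b) = aug_act \<sigma> a * aug_act \<sigma> b"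
  by (induction a rule: aug_chow.abs_induct, induction b rule: aug_chow.abs_induct)
    (simp add: aug_act_class map_vars_mult flip: aug_class_simps(6))

lemma aug_act_0: "aug_act \<sigma> 0 = 0"
  using aug_act_class[of \<sigma> 0] by (simp add: aug_class_simps)

lemma aug_act_1: "aug_act \<sigma> 1 = 1"
  using aug_act_class[of \<sigma> 1] map_vars_single[of "perm_var \<sigma>" 0 1]
  by (simp add: aug_class_simps map_mon_def)

lemma aug_act_uminus: "aug_act \<sigma> (- a) = - aug_act \<sigma> a"
  using aug_act_add[of \<sigma> a "- a"] by (simp add: aug_act_0 eq_neg_iff_add_eq_0 add.commute)

lemma aug_act_sum: "aug_act \<sigma> (\<Sum>x\<in>A. f x) = (\<Sum>x\<in>A. aug_act \<sigma> (f x))"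
  by (induction A rule: infinite_finite_induct) (simp_all add: aug_act_0 aug_act_add)

lemma aug_act_power: "aug_act \<sigma> (a ^ k) = aug_act \<sigma> a ^ k"
  by (induction k) (simp_all add: aug_act_1 aug_act_mult)

text \<open>The case F = [n] is separate: x_[n] is minus the sum of the other x_F, which the
  permutation merely reindexes.\<close>

lemma aug_act_x_elem: "aug_act \<sigma> (x_elem F) = x_elem (Perm.apply \<sigma> ` F)"
proof (cases "F = UNIV")
  case True
  have "aug_act \<sigma> (x_elem F) =
      - (\<Sum>G\<in>UNIV. aug_class (pvar (X (Proper (Perm.apply \<sigma> ` elems G)))))"
    by (simp add: True x_elem_def aug_act_uminus aug_act_sum aug_act_class perm_var_def)
  also have "\<dots> = x_elem UNIV"
    using sum.reindex_bij_betw[OF perm_proper_bij[of \<sigma>], of "\<lambda>G. aug_class (pvar (X G))"]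
    by (simp add: x_elem_def)
  also have "UNIV = Perm.apply \<sigma> ` F"
    using True bij_apply[of \<sigma>] by (simp add: bij_def)
  finally show ?thesis .
next
  case False
  then obtain G where F: "F = elems G" using range_elems by (metis DiffI UNIV_I image_iff singletonD)
  show ?thesis
    using x_elem_elems[of "Proper (Perm.apply \<sigma> ` elems G)"]
    by (simp add: F x_elem_elems aug_act_class perm_var_def elems_Proper_perm)
qed

definition perm_list :: "'n perm \<Rightarrow> ('n set \<times> nat) list \<Rightarrow> ('n set \<times> nat) list"
  where "perm_list \<sigma> = map (\<lambda>(F, a). (Perm.apply \<sigma> ` F, a))"

lemma aug_act_fy_class: "aug_act \<sigma> (fy_class fs) = fy_class (perm_list \<sigma> fs)"
  by (induction fs)
    (auto simp: fy_class_def perm_list_def aug_act_1 aug_act_mult aug_act_power aug_act_x_elem)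

lemma perm_list_inverse: "perm_list \<sigma> (perm_list (inverse \<sigma>) fs) = fs"
proof -
  have "Perm.apply \<sigma> ` Perm.apply (inverse \<sigma>) ` F = F" for F
    using bij_apply[of \<sigma>] by (simp add: apply_inverse bij_def image_f_inv_f)
  then show ?thesis by (simp add: perm_list_def comp_def case_prod_unfold)
qed

lemma perm_list_FY:
  assumes "fs \<in> FY"
  shows "perm_list \<sigma> fs \<in> FY"
proof -
  have psub: "Perm.apply \<sigma> ` A \<subset> Perm.apply \<sigma> ` B \<longleftrightarrow> A \<subset> B" for A B
    by (simp only: less_le_not_le perm_image_subset)
  have card: "card (Perm.apply \<sigma> ` A) = card A" for A
    using bij_apply[of \<sigma>] by (intro card_image) (meson bij_def inj_on_subset subset_UNIV)
  show ?thesis using assms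
    by (auto simp: FY_def perm_list_def sorted_wrt_map psub card case_prod_unfold)
qed

lemma perm_list_FY_deg:
  assumes "fs \<in> FY_deg k"
  shows "perm_list \<sigma> fs \<in> FY_deg k"
proof -
  have "map snd (perm_list \<sigma> fs) = map snd fs"
    by (simp add: perm_list_def comp_def case_prod_unfold)
  then show ?thesis using assms by (auto simp: FY_deg_def intro: perm_list_FY)
qed

text \<open>Closure under all permutations suffices, since the inverse permutation supplies
  preimages.\<close>

lemma aug_act_image_fy_class:
  assumes "\<And>\<sigma> fs. fs \<in> S \<Longrightarrow> perm_list \<sigma> fs \<in> S"
  shows "aug_act \<sigma> ` fy_class ` S = fy_class ` S"
proof (intro equalityI subsetI)
  fix a assume "a \<in> fy_class ` S"
  then obtain fs where fs: "fs \<in> S" "a = fy_class fs" by blast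
  then have "a = aug_act \<sigma> (fy_class (perm_list (inverse \<sigma>) fs))"
    by (simp add: aug_act_fy_class perm_list_inverse)
  with assms fs(1) show "a \<in> aug_act \<sigma> ` fy_class ` S" by blast
qed (use assms in \<open>auto simp: aug_act_fy_class\<close>)

section \<open>Assembling the permutation bases\<close>

lemma inj_on_fy_class: "inj_on fy_class FY"
proof (rule inj_onI, rule ccontr)
  fix fs gs :: "('n::finite set \<times> nat) list"
  assume fs: "fs \<in> FY" and gs: "gs \<in> FY" and eq: "fy_class fs = fy_class gs" and "fs \<noteq> gs"
  \<comment> \<open>Two distinct lists with the same class would give a relation with coefficients 1
    and -1.\<close>
  let ?c = "\<lambda>hs. if hs = fs then 1 else if hs = gs then - 1 else (0 :: rat)"
  have "(\<Sum>hs\<in>FY. aug_scale (?c hs) (fy_class hs)) =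
      (\<Sum>hs\<in>FY. (if hs = fs then fy_class fs else 0) - (if hs = gs then fy_class gs else 0))"
    using \<open>fs \<noteq> gs\<close> by (intro sum.cong) auto
  also have "\<dots> = 0"
    using fs gs eq by (simp add: sum_subtractf card_FY(1))
  finally have "?c fs = 0" using fs by (rule fy_class_relation_trivial)
  then show False by simp
qed

lemma independent_fy_class:
  "aug.independent (fy_class ` (FY :: ('n::finite set \<times> nat) list set))"
proof (rule aug.independent_if_scalars_zero)
  fix c :: "'n aug_chow \<Rightarrow> rat" and x
  assume "(\<Sum>x\<in>fy_class ` (FY :: ('n set \<times> nat) list set). aug_scale (c x) x) = 0" "x \<in> fy_class ` (FY :: ('n set \<times> nat) list set)"
  then show "c x = 0"
    using fy_class_relation_trivial[of "\<lambda>fs. c (fy_class fs)"]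
    by (auto simp: sum.reindex[OF inj_on_fy_class])
qed (simp add: card_FY(1))

lemma span_fy_class_FY_deg:
  "aug.span (fy_class ` FY_deg k) = (aug_component k :: 'n::finite aug_chow set)"
proof (rule antisym)
  have "aug.subspace (aug_component k :: 'n aug_chow set)"
  proof (rule aug.subspaceI)
    show "0 \<in> (aug_component k :: 'n aug_chow set)"
      unfolding aug_component_def using homogeneous_0 by (force simp flip: aug_class_simps(1))
    fix c and x y :: "'n aug_chow" assume "x \<in> aug_component k" "y \<in> aug_component k"
    then obtain p q where pq: "homogeneous k p" "homogeneous k q" "x = aug_class p" "y = aug_class q"
      by (auto simp: aug_component_def)
    then show "x + y \<in> aug_component k"
      unfolding aug_component_def by (auto simp flip: aug_class_simps(3) intro: homogeneous_add)
    show "aug_scale c x \<in> aug_component k"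
      using homogeneous_mult[OF homogeneous_pconst pq(1)]
      unfolding aug_component_def by (auto simp: pq aug_scale_class)
  qed
  moreover have "fy_class fs \<in> (aug_component k :: 'n aug_chow set)" if "fs \<in> FY_deg k" for fs
    using that homogeneous_fy_poly[of fs]
    unfolding aug_component_def by (auto simp: FY_deg_def simp flip: aug_class_fy_poly)
  ultimately show "aug.span (fy_class ` FY_deg k) \<subseteq> (aug_component k :: 'n aug_chow set)"
    by (intro aug.span_minimal) auto
  show "(aug_component k :: 'n aug_chow set) \<subseteq> aug.span (fy_class ` FY_deg k)"
    unfolding aug_component_def using aug_class_homogeneous_in_span_FY by blast
qed

lemma span_fy_class_FY: "aug.span (fy_class ` FY) = UNIV"
proof -
  have "a \<in> aug.span (fy_class ` FY)" for a :: "'n::finite aug_chow"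
  proof (induction a rule: aug_chow.abs_induct)
    fix p :: "'n chow_var qpoly"
    have "aug_class (Poly_Mapping.single m c) \<in> aug.span (fy_class ` FY)"
      for m :: "'n chow_var \<Rightarrow>\<^sub>0 nat" and c
      using aug_class_homogeneous_in_span_FY[OF homogeneous_single]
        aug.span_mono[of "fy_class ` FY_deg _" "fy_class ` FY"] by (auto simp: FY_deg_def)
    then show "aug_class p \<in> aug.span (fy_class ` FY)"
      by (subst qpoly_expand) (auto simp: aug_class_sum intro: aug.span_sum)
  qed
  then show ?thesis by blast
qed

text \<open>The equality of ideals carries the result over to the Chow ring of the fan. Injectivity
  records that distinct monomials have distinct classes, which the image sets alone would
  hide.\<close>

theorem theorem4p6:
  shows "(stell_chow_ideal :: 'n::finite chow_var qpoly set) = aug_ideal \<and>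
    inj_on fy_class (FY :: ('n set \<times> nat) list set) \<and>
    permutation_basis (fy_class ` (FY :: ('n set \<times> nat) list set)) UNIV \<and>
    (\<forall>k\<le>CARD('n).
      permutation_basis (fy_class ` (FY_deg k :: ('n set \<times> nat) list set)) (aug_component k))"
proof (intro conjI allI impI)
  show "permutation_basis (fy_class ` (FY :: ('n set \<times> nat) list set)) UNIV"
    unfolding permutation_basis_def
    by (simp add: independent_fy_class span_fy_class_FY aug_act_image_fy_class perm_list_FY)
  fix k
  have "fy_class ` FY_deg k \<subseteq> fy_class ` (FY :: ('n set \<times> nat) list set)"
    by (auto simp: FY_deg_def)
  then show "permutation_basis (fy_class ` (FY_deg k :: ('n set \<times> nat) list set)) (aug_component k)"
    unfolding permutation_basis_def
    using aug.independent_mono[OF independent_fy_class]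
    by (simp add: span_fy_class_FY_deg aug_act_image_fy_class perm_list_FY_deg)
qed (rule stell_chow_ideal_eq inj_on_fy_class)+

end
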